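(* For every metrisable pointed coarse space $(X,\xi)$ in $\mathscr{C}$, the map $\omega_{(X,\xi)}\colon\sigma(X,\xi)\to\iota(X,\xi)$, $[s]_{\equiv^{\sigma}_{X,\xi}}\mapsto[{}^{*}s(i)]_{\equiv^{\iota}_{X,\xi}}$ (where $i\in{}^{*}\mathbb{N}\setminus\mathbb{N}$ is arbitrary), is injective.
   Context: A coarse structure on a set $X$ is an ideal $\mathcal{C}_X$ of the poset $(\mathcal{P}(X\times X),\subseteq)$ containing the diagonal and closed under composition $E\circ F=\{(x,y)\mid \exists z\in X,\ (x,z)\in E,\ (z,y)\in F\}$ and inversion; its elements are called controlled sets. A coarse space is a set with a coarse structure. $B\subseteq X$ is bounded if $B\times B\in\mathcal{C}_X$. A map between coarse spaces is proper if preimages of bounded sets are bounded, bornologous if $(f\times f)(E)$ is controlled for each controlled $E$, and coarse if proper and bornologous. $\mathbf{Coarse}_*$ is the category of pointed coarse spaces and basepoint-preserving coarse maps. A (generalised) metric $d_X\colon X\times X\to\mathbb{R}_{\ge0}\cup\{+\infty\}$ induces the bounded coarse structure $\{E\subseteq X\times X\mid\sup d_X(E)<+\infty\}$. A coarse space is metrisable if its coarse structure is the bounded coarse structure of some such metric. A coarse sequence in $(X,\xi)$ is a coarse map $s\colon(\mathbb{N},0)\to(X,\xi)$, where $\mathbb{N}$ has the bounded coarse structure of $|i-j|$. $S(X,\xi)$ is the set of coarse sequences in $(X,\xi)$. For $s,t\in S(X,\xi)$, $s\equiv^{\sigma}_{X,\xi}t$ if there is a finite sequence $s=s_0,\dots,s_n=t$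 in $S(X,\xi)$ such that for each $i<n$ one of $s_i,s_{i+1}$ is a subsequence of the other. Put $\sigma(X,\xi):=S(X,\xi)/{\equiv^{\sigma}_{X,\xi}}$. Nonstandard setting: $\mathscr{C}$ is a fixed small full subcategory of $\mathbf{Coarse}_*$; $\mathbb{U}$ (the standard universe) is a transitive set containing $\mathscr{C}$ and all classical objects needed, with respect to which the needed set-theoretic formulae are absolute; ${}^{*}\colon\mathbb{U}\hookrightarrow{}^{*}\mathbb{U}$, $x\mapsto{}^{*}x$, is a fixed sufficiently saturated elementary extension (families of internal sets indexed by a set in $\mathbb{U}$ and having the finite intersection property have nonempty intersection). Points $x$ of a standard space are identified with ${}^{*}x$. "Standard" means belonging to $\mathbb{U}$. For a standard coarse space $X$ and $x,y\in{}^{*}X$, $x\sim_X y$ iff $(x,y)\in{}^{*}E$ for some (standard) $E\in\mathcal{C}_X$. $\operatorname{INF}(X,\xi):=\{x\in{}^{*}X\mid x\not\sim_X\xi\}$. For $x,y\in\operatorname{INF}(X,\xi)$, $x\equiv^{\iota}_{X,\xi}y$ if there is an internal hyperfinite sequence $\{x_i\}_{i\le n}$ ($n\in{}^{*}\mathbb{N}$) in $\operatorname{INF}(X,\xi)$ with $x_0=x$, $x_n=y$ and $x_i\sim_X x_{i+1}$ for all $i<n$. Put $\iota(X,\xi):=\operatorname{INF}(X,\xi)/{\equiv^{\iota}_{X,\xi}}$. The map $\omega_{(X,\xi)}$ is well-defined for every $(X,\xi)$ in $\mathscr{C}$, independently of the choice of $s$ in its class and of the infinite index $i$. *)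

theory Defs
  imports Complex_Main "HOL-Library.FuncSet" "HOL-Library.Extended_Nonnegative_Real"
begin

section \<open>Coarse spaces\<close>

text \<open>A coarse structure on \<open>X\<close> is an ideal of the lattice \<open>Pow (X \<times> X)\<close> with the listed
  closure properties; the composition \<open>E O F\<close> of the library is exactly
  \<open>{(x, y). \<exists>z. (x, z) \<in> E \<and> (z, y) \<in> F}\<close>.\<close>

definition coarse_structure :: "'a set \<Rightarrow> ('a \<times> 'a) set set \<Rightarrow> bool" where
  "coarse_structure X C \<longleftrightarrow>
     C \<subseteq> Pow (X \<times> X) \<and>
     (\<forall>E\<in>C. \<forall>F. F \<subseteq> E \<longrightarrow> F \<in> C) \<and>
     (\<forall>E\<in>C. \<forall>F\<in>C. E \<union> F \<in> C) \<and>
     Id_on X \<in> C \<and>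
     (\<forall>E\<in>C. \<forall>F\<in>C. E O F \<in> C) \<and>
     (\<forall>E\<in>C. E\<inverse> \<in> C)"

definition pointed_coarse_space :: "'a set \<Rightarrow> ('a \<times> 'a) set set \<Rightarrow> 'a \<Rightarrow> bool" where
  "pointed_coarse_space X C \<xi> \<longleftrightarrow> coarse_structure X C \<and> \<xi> \<in> X"

definition coarsely_bounded :: "'a set \<Rightarrow> ('a \<times> 'a) set set \<Rightarrow> 'a set \<Rightarrow> bool" where
  "coarsely_bounded X C B \<longleftrightarrow> B \<subseteq> X \<and> B \<times> B \<in> C"

definition proper_map ::
  "'a set \<Rightarrow> ('a \<times> 'a) set set \<Rightarrow> 'b set \<Rightarrow> ('b \<times> 'b) set set \<Rightarrow> ('a \<Rightarrow> 'b) \<Rightarrow> bool" where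
  "proper_map X C Y D f \<longleftrightarrow>
     (\<forall>B. coarsely_bounded Y D B \<longrightarrow> coarsely_bounded X C (f -` B \<inter> X))"

definition bornologous ::
  "('a \<times> 'a) set set \<Rightarrow> ('b \<times> 'b) set set \<Rightarrow> ('a \<Rightarrow> 'b) \<Rightarrow> bool" where
  "bornologous C D f \<longleftrightarrow> (\<forall>E\<in>C. map_prod f f ` E \<in> D)"

definition pointed_coarse_map ::
  "'a set \<Rightarrow> ('a \<times> 'a) set set \<Rightarrow> 'a \<Rightarrow> 'b set \<Rightarrow> ('b \<times> 'b) set set \<Rightarrow> 'b \<Rightarrow> ('a \<Rightarrow> 'b) \<Rightarrow> bool" where
  "pointed_coarse_map X C \<xi> Y D \<eta> f \<longleftrightarrow>
     f \<in> X \<rightarrow> Y \<and> proper_map X C Y D f \<and> bornologous C D f \<and> f \<xi> = \<eta>"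

definition generalised_metric :: "'a set \<Rightarrow> ('a \<Rightarrow> 'a \<Rightarrow> ennreal) \<Rightarrow> bool" where
  "generalised_metric X d \<longleftrightarrow>
     (\<forall>x\<in>X. \<forall>y\<in>X. d x y = 0 \<longleftrightarrow> x = y) \<and>
     (\<forall>x\<in>X. \<forall>y\<in>X. d x y = d y x) \<and>
     (\<forall>x\<in>X. \<forall>y\<in>X. \<forall>z\<in>X. d x z \<le> d x y + d y z)"

definition bounded_coarse_structure ::
  "'a set \<Rightarrow> ('a \<Rightarrow> 'a \<Rightarrow> ennreal) \<Rightarrow> ('a \<times> 'a) set set" where
  "bounded_coarse_structure X d = {E. E \<subseteq> X \<times> X \<and> (SUP (x, y)\<in>E. d x y) < \<infinity>}"

definition metrisable :: "'a set \<Rightarrow> ('a \<times> 'a) set set \<Rightarrow> bool" where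
  "metrisable X C \<longleftrightarrow> (\<exists>d. generalised_metric X d \<and> C = bounded_coarse_structure X d)"


section \<open>Coarse sequences\<close>

definition nat_coarse :: "(nat \<times> nat) set set" where
  "nat_coarse = bounded_coarse_structure UNIV (\<lambda>i j. ennreal \<bar>real i - real j\<bar>)"

definition coarse_seqs :: "'a set \<Rightarrow> ('a \<times> 'a) set set \<Rightarrow> 'a \<Rightarrow> (nat \<Rightarrow> 'a) set" where
  "coarse_seqs X C \<xi> = {s. pointed_coarse_map UNIV nat_coarse 0 X C \<xi> s}"

definition subsequence :: "(nat \<Rightarrow> 'a) \<Rightarrow> (nat \<Rightarrow> 'a) \<Rightarrow> bool" where
  "subsequence s t \<longleftrightarrow> (\<exists>\<kappa>. strict_mono \<kappa> \<and> s = t \<circ> \<kappa>)"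

definition sigma_eq ::
  "'a set \<Rightarrow> ('a \<times> 'a) set set \<Rightarrow> 'a \<Rightarrow> ((nat \<Rightarrow> 'a) \<times> (nat \<Rightarrow> 'a)) set" where
  "sigma_eq X C \<xi> = {(s, t). \<exists>(n::nat) u.
     u 0 = s \<and> u n = t \<and> (\<forall>i\<le>n. u i \<in> coarse_seqs X C \<xi>) \<and>
     (\<forall>i<n. subsequence (u i) (u (Suc i)) \<or> subsequence (u (Suc i)) (u i))}"

definition sigma :: "'a set \<Rightarrow> ('a \<times> 'a) set set \<Rightarrow> 'a \<Rightarrow> (nat \<Rightarrow> 'a) set set" where
  "sigma X C \<xi> = coarse_seqs X C \<xi> // sigma_eq X C \<xi>"


section \<open>Structures for the language of set theory\<close>

text \<open>First-order formulae over \<open>\<in>\<close> and \<open>=\<close>, with variables named by natural numbers.\<close>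

datatype fm = Mem nat nat | Eq nat nat | Neg fm | Conj fm fm | All nat fm

primrec sat :: "('u \<Rightarrow> 'u \<Rightarrow> bool) \<Rightarrow> fm \<Rightarrow> (nat \<Rightarrow> 'u) \<Rightarrow> bool" where
  "sat E (Mem i j) v \<longleftrightarrow> E (v i) (v j)"
| "sat E (Eq i j) v \<longleftrightarrow> v i = v j"
| "sat E (Neg \<phi>) v \<longleftrightarrow> \<not> sat E \<phi> v"
| "sat E (Conj \<phi> \<psi>) v \<longleftrightarrow> sat E \<phi> v \<and> sat E \<psi> v"
| "sat E (All i \<phi>) v \<longleftrightarrow> (\<forall>a. sat E \<phi> (v(i := a)))"

definition elts :: "('u \<Rightarrow> 'u \<Rightarrow> bool) \<Rightarrow> 'u \<Rightarrow> 'u set" where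
  "elts E x = {y. E y x}"

text \<open>A set \<open>A\<close> of points belongs to an extensional structure \<open>E\<close> iff \<open>A \<in> range (elts E)\<close>;
  \<open>code E A\<close> is then the point representing it (and is meaningless otherwise).
  Pairs are Kuratowski pairs, relations and functions are sets of pairs, and natural numbers
  are von Neumann numerals.\<close>

definition code :: "('u \<Rightarrow> 'u \<Rightarrow> bool) \<Rightarrow> 'u set \<Rightarrow> 'u" where
  "code E A = (THE x. elts E x = A)"

definition kpair :: "('u \<Rightarrow> 'u \<Rightarrow> bool) \<Rightarrow> 'u \<Rightarrow> 'u \<Rightarrow> 'u" where
  "kpair E x y = code E {code E {x}, code E {x, y}}"

definition rel_code :: "('u \<Rightarrow> 'u \<Rightarrow> bool) \<Rightarrow> ('u \<times> 'u) set \<Rightarrow> 'u" where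
  "rel_code E R = code E ((\<lambda>(x, y). kpair E x y) ` R)"

primrec num :: "('u \<Rightarrow> 'u \<Rightarrow> bool) \<Rightarrow> nat \<Rightarrow> 'u" where
  "num E 0 = code E {}"
| "num E (Suc n) = code E (insert (num E n) (elts E (num E n)))"

definition space_code ::
  "('u \<Rightarrow> 'u \<Rightarrow> bool) \<Rightarrow> 'u set \<times> ('u \<times> 'u) set set \<times> 'u \<Rightarrow> 'u" where
  "space_code E = (\<lambda>(X, C, \<xi>). kpair E (code E X) (kpair E (code E (rel_code E ` C)) \<xi>))"


section \<open>The nonstandard setting\<close>

text \<open>The standard universe is the whole type \<open>'u\<close> with membership relation \<open>mem\<close>.  By Mostowski's
  theorem, a well-founded extensional structure is a transitive set up to a unique isomorphism.
  The remaining conditions fix the meaning of ``contains all classical objects needed, and the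
  needed formulae are absolute'': closure under genuine subsets, pairs, unions and products, and
  \<open>\<nat>\<close> is an element.  Every \<open>V\<^sub>\<lambda>\<close> with \<open>\<lambda> > \<omega>\<close> a limit and every \<open>H\<^sub>\<kappa>\<close> with \<open>\<kappa> > \<omega>\<close> regular
  satisfies them.\<close>

locale standard_universe =
  fixes mem :: "'u \<Rightarrow> 'u \<Rightarrow> bool"
  assumes mem_wf: "wfp mem"
    and mem_ext: "inj (elts mem)"
    and mem_subset: "A \<subseteq> elts mem x \<Longrightarrow> A \<in> range (elts mem)"
    and mem_pair: "{x, y} \<in> range (elts mem)"
    and mem_Union: "(\<Union>y\<in>elts mem x. elts mem y) \<in> range (elts mem)"
    and mem_times: "(\<lambda>(a, b). kpair mem a b) ` (elts mem x \<times> elts mem y) \<in> range (elts mem)"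
    and mem_omega: "range (num mem) \<in> range (elts mem)"

text \<open>The nonstandard universe is the type \<open>'v\<close> with (in general ill-founded) membership relation
  \<open>nmem\<close>; its points are the internal objects, and the internal sets are the sets
  \<open>elts nmem b\<close>.  \<open>Cat\<close> is the object set of the small category \<open>\<C>\<close>, with a pointed coarse space
  given as a triple (carrier, controlled sets, base point); being a full subcategory, \<open>\<C>\<close> is
  determined by its objects.\<close>

locale nonstandard_setting = standard_universe mem
  for mem :: "'u \<Rightarrow> 'u \<Rightarrow> bool" +
  fixes nmem :: "'v \<Rightarrow> 'v \<Rightarrow> bool"
    and star :: "'u \<Rightarrow> 'v"
    and Cat :: "('u set \<times> ('u \<times> 'u) set set \<times> 'u) set"
  assumes elementary: "sat nmem \<phi> (star \<circ> v) \<longleftrightarrow> sat mem \<phi> v"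
    and saturated: "(\<And>J. finite J \<Longrightarrow> J \<subseteq> elts mem I \<Longrightarrow> (\<Inter>j\<in>J. elts nmem (F j)) \<noteq> {}) \<Longrightarrow>
           (\<Inter>j\<in>elts mem I. elts nmem (F j)) \<noteq> {}"
    and Cat_spaces: "(X, C, \<xi>) \<in> Cat \<Longrightarrow> pointed_coarse_space X C \<xi>"
    and Cat_elements: "(X, C, \<xi>) \<in> Cat \<Longrightarrow>
           X \<in> range (elts mem) \<and> rel_code mem ` C \<in> range (elts mem)"
    and Cat_in_universe: "space_code mem ` Cat \<in> range (elts mem)"
begin

definition star_set :: "'u set \<Rightarrow> 'v set" where
  "star_set A = elts nmem (star (code mem A))"

definition star_rel :: "('u \<times> 'u) set \<Rightarrow> ('v \<times> 'v) set" where
  "star_rel R = {(x, y). kpair nmem x y \<in> elts nmem (star (rel_code mem R))}"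

definition hypernats :: "'v set" where
  "hypernats = star_set (range (num mem))"

definition infinite_hypernats :: "'v set" where
  "infinite_hypernats = hypernats - range (\<lambda>n. star (num mem n))"

definition hyper_le :: "('v \<times> 'v) set" where
  "hyper_le = star_rel {(num mem i, num mem j) | i j. i \<le> j}"

definition hyper_less :: "('v \<times> 'v) set" where
  "hyper_less = star_rel {(num mem i, num mem j) | i j. i < j}"

definition hyper_Suc :: "('v \<times> 'v) set" where
  "hyper_Suc = star_rel {(num mem i, num mem (Suc i)) | i. True}"

definition star_seq :: "(nat \<Rightarrow> 'u) \<Rightarrow> 'v \<Rightarrow> 'v" where
  "star_seq s i = (THE y. (i, y) \<in> star_rel {(num mem k, s k) | k. True})"

definition finitely_close :: "('u \<times> 'u) set set \<Rightarrow> 'v \<Rightarrow> 'v \<Rightarrow> bool" where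
  "finitely_close C x y \<longleftrightarrow> (\<exists>E\<in>C. (x, y) \<in> star_rel E)"

definition INF_points :: "'u set \<Rightarrow> ('u \<times> 'u) set set \<Rightarrow> 'u \<Rightarrow> 'v set" where
  "INF_points X C \<xi> = {x \<in> star_set X. \<not> finitely_close C x (star \<xi>)}"

text \<open>Only the values of \<open>x\<close> at hypernaturals \<open>i \<le> n\<close> matter: the restriction of \<open>x\<close> to these is
  required to be an internal function.\<close>

definition internal_seq :: "'v \<Rightarrow> ('v \<Rightarrow> 'v) \<Rightarrow> bool" where
  "internal_seq n x \<longleftrightarrow>
     (\<exists>g. elts nmem g = (\<lambda>i. kpair nmem i (x i)) ` {i \<in> hypernats. (i, n) \<in> hyper_le})"

definition iota_eq :: "'u set \<Rightarrow> ('u \<times> 'u) set set \<Rightarrow> 'u \<Rightarrow> ('v \<times> 'v) set" where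
  "iota_eq X C \<xi> = {(a, b). a \<in> INF_points X C \<xi> \<and> b \<in> INF_points X C \<xi> \<and>
     (\<exists>n\<in>hypernats. \<exists>x. internal_seq n x \<and>
        (\<forall>i\<in>hypernats. (i, n) \<in> hyper_le \<longrightarrow> x i \<in> INF_points X C \<xi>) \<and>
        x (star (num mem 0)) = a \<and> x n = b \<and>
        (\<forall>i j. (i, n) \<in> hyper_less \<and> (i, j) \<in> hyper_Suc \<longrightarrow> finitely_close C (x i) (x j)))}"

definition iota :: "'u set \<Rightarrow> ('u \<times> 'u) set set \<Rightarrow> 'u \<Rightarrow> 'v set set" where
  "iota X C \<xi> = INF_points X C \<xi> // iota_eq X C \<xi>"

text \<open>The value at a \<open>\<sigma>\<close>-class \<open>c\<close> is the \<open>\<iota>\<close>-class common to all \<open>star_seq s i\<close> with \<open>s\<close> in \<open>c\<close>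
  and \<open>i\<close> infinite; it is meaningful only because these classes all coincide.\<close>

definition omega :: "'u set \<Rightarrow> ('u \<times> 'u) set set \<Rightarrow> 'u \<Rightarrow> (nat \<Rightarrow> 'u) set \<Rightarrow> 'v set" where
  "omega X C \<xi> c =
     (THE k. k \<in> iota X C \<xi> \<and>
        (\<forall>s\<in>c. \<forall>i\<in>infinite_hypernats. k = iota_eq X C \<xi> `` {star_seq s i}))"

end

end

theory Submission
  imports Defs
begin

text \<open>Metrisability gives a countable cofinal family of controlled sets \<open>E\<^sub>m\<close>. Call \<open>a\<close> and \<open>b\<close>
  \<open>(m, r)\<close>-connected if a finite \<open>E\<^sub>m\<close>-path joins them outside the balls of index below \<open>r\<close> around
  \<open>\<xi>\<close>. Two coarse sequences are \<open>\<sigma>\<close>-equivalent iff for some \<open>m\<close> and all \<open>r\<close> their tails are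
  \<open>(m, r)\<close>-connected: concatenating connecting paths \<open>s 0, t 0, s 1, t 1, \<dots>\<close> yields a coarse
  sequence of which both are subsequences. Two points at infinity are \<open>\<iota>\<close>-equivalent iff for some
  standard \<open>m\<close> and all standard \<open>r\<close> they are \<open>*\<close>-\<open>(m, r)\<close>-connected: saturation bounds the steps of
  an internal path by one \<open>E\<^sub>m\<close>, and overspill in \<open>r\<close> produces an internal path at infinity.
  Transfer identifies the two conditions, so \<open>\<sigma>\<close>-equivalence of \<open>s\<close> and \<open>t\<close> is the same as
  \<open>\<iota>\<close>-equivalence of \<open>*s(i)\<close> and \<open>*t(j)\<close> for infinite \<open>i\<close> and \<open>j\<close>.\<close>

section \<open>Coarse sequences in a metrisable space\<close>

text \<open>A finite supremum in \<open>ennreal\<close> lies below some natural number, so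
  controlled sets are those of bounded index difference. The additive form of the bound avoids
  truncated subtraction.\<close>

lemma nat_coarse_iff:
  "F \<in> nat_coarse \<longleftrightarrow> (\<exists>k. \<forall>(i, j)\<in>F. i \<le> j + k \<and> j \<le> i + k)"
proof
  assume "F \<in> nat_coarse"
  then have "(SUP (i, j)\<in>F. ennreal \<bar>real i - real j\<bar>) < \<infinity>"
    by (simp add: nat_coarse_def bounded_coarse_structure_def)
  then obtain k :: nat where k: "(SUP (i, j)\<in>F. ennreal \<bar>real i - real j\<bar>) < of_nat k"
    using ennreal_Ex_less_of_nat by (metis infinity_ennreal_def)
  have "i \<le> j + k \<and> j \<le> i + k" if "(i, j) \<in> F" for i j
  proof -
    have "ennreal \<bar>real i - real j\<bar> \<le> (SUP (i, j)\<in>F. ennreal \<bar>real i - real j\<bar>)"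
      using that by (intro SUP_upper2[of "(i, j)"]) auto
    with k have "ennreal \<bar>real i - real j\<bar> < of_nat k" by order
    then have "\<bar>real i - real j\<bar> < real k"
      by (simp add: ennreal_of_nat_eq_real_of_nat ennreal_less_iff)
    then show ?thesis by linarith
  qed
  then show "\<exists>k. \<forall>(i, j)\<in>F. i \<le> j + k \<and> j \<le> i + k" by blast
next
  assume "\<exists>k. \<forall>(i, j)\<in>F. i \<le> j + k \<and> j \<le> i + k"
  then obtain k where k: "\<And>i j. (i, j) \<in> F \<Longrightarrow> i \<le> j + k \<and> j \<le> i + k" by blast
  have "(SUP (i, j)\<in>F. ennreal \<bar>real i - real j\<bar>) \<le> of_nat k"
  proof (intro SUP_least, clarify)
    fix i j assume "(i, j) \<in> F"
    then have "\<bar>real i - real j\<bar> \<le> real k" using k[of i j] by linarith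
    then show "ennreal \<bar>real i - real j\<bar> \<le> of_nat k"
      by (simp add: ennreal_of_nat_eq_real_of_nat ennreal_leI)
  qed
  then have "(SUP (i, j)\<in>F. ennreal \<bar>real i - real j\<bar>) < \<infinity>"
    by (rule order_le_less_trans) (simp add: of_nat_less_top)
  then show "F \<in> nat_coarse"
    by (simp add: nat_coarse_def bounded_coarse_structure_def)
qed

section \<open>Sigma-equivalence as a relation generated by subsequences\<close>

definition sigma_step ::
  "'a set \<Rightarrow> ('a \<times> 'a) set set \<Rightarrow> 'a \<Rightarrow> ((nat \<Rightarrow> 'a) \<times> (nat \<Rightarrow> 'a)) set" where
  "sigma_step X C \<xi> = {(u, v). u \<in> coarse_seqs X C \<xi> \<and> v \<in> coarse_seqs X C \<xi> \<and>
     (subsequence u v \<or> subsequence v u)}"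

text \<open>Turns the chains into a reflexive transitive closure, so that library rules give
  symmetry and transitivity. Membership of \<open>s\<close> is stated separately because the closure
  also relates every non-coarse sequence to itself.\<close>

lemma sigma_eq_iff:
  "(s, t) \<in> sigma_eq X C \<xi> \<longleftrightarrow> s \<in> coarse_seqs X C \<xi> \<and> (s, t) \<in> (sigma_step X C \<xi>)\<^sup>*"
proof
  assume "(s, t) \<in> sigma_eq X C \<xi>"
  then obtain n u where u: "u 0 = s" "u n = t" "\<forall>i\<le>n. u i \<in> coarse_seqs X C \<xi>"
    "\<forall>i<n. subsequence (u i) (u (Suc i)) \<or> subsequence (u (Suc i)) (u i)"
    unfolding sigma_eq_def by blast
  then have "\<forall>i<n. (u i, u (Suc i)) \<in> sigma_step X C \<xi>"
    by (simp add: sigma_step_def)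
  then have "(s, t) \<in> sigma_step X C \<xi> ^^ n"
    unfolding relpow_fun_conv using u(1,2) by blast
  with u show "s \<in> coarse_seqs X C \<xi> \<and> (s, t) \<in> (sigma_step X C \<xi>)\<^sup>*"
    using relpow_imp_rtrancl by blast
next
  assume *: "s \<in> coarse_seqs X C \<xi> \<and> (s, t) \<in> (sigma_step X C \<xi>)\<^sup>*"
  then obtain n where "(s, t) \<in> sigma_step X C \<xi> ^^ n"
    using rtrancl_imp_relpow by blast
  then obtain u where u: "u 0 = s" "u n = t" "\<forall>i<n. (u i, u (Suc i)) \<in> sigma_step X C \<xi>"
    unfolding relpow_fun_conv by blast
  have "u i \<in> coarse_seqs X C \<xi>" if "i \<le> n" for i
  proof (cases i)
    case 0
    then show ?thesis using * u by simp
  next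
    case (Suc j)
    then have "(u j, u i) \<in> sigma_step X C \<xi>" using u that by simp
    then show ?thesis by (simp add: sigma_step_def)
  qed
  moreover have "\<forall>i<n. subsequence (u i) (u (Suc i)) \<or> subsequence (u (Suc i)) (u i)"
    using u(3) by (simp add: sigma_step_def)
  ultimately show "(s, t) \<in> sigma_eq X C \<xi>"
    unfolding sigma_eq_def using u(1,2) by blast
qed

lemma sigma_eq_sym: "(s, t) \<in> sigma_eq X C \<xi> \<Longrightarrow> (t, s) \<in> sigma_eq X C \<xi>"
proof -
  assume *: "(s, t) \<in> sigma_eq X C \<xi>"
  have "sym (sigma_step X C \<xi>)" by (auto simp: sigma_step_def sym_def)
  then have "(t, s) \<in> (sigma_step X C \<xi>)\<^sup>*"
    using * by (metis sigma_eq_iff sym_rtrancl symD)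
  moreover have "t \<in> coarse_seqs X C \<xi>"
    using * by (auto simp: sigma_eq_def)
  ultimately show ?thesis by (simp add: sigma_eq_iff)
qed

lemma sigma_eq_trans:
  "(s, t) \<in> sigma_eq X C \<xi> \<Longrightarrow> (t, u) \<in> sigma_eq X C \<xi> \<Longrightarrow> (s, u) \<in> sigma_eq X C \<xi>"
  by (auto simp: sigma_eq_iff)

lemma subsequence_sigma_eq:
  assumes "s \<in> coarse_seqs X C \<xi>" "u \<in> coarse_seqs X C \<xi>" "subsequence s u"
  shows "(s, u) \<in> sigma_eq X C \<xi>"
proof -
  have "(s, u) \<in> sigma_step X C \<xi>" using assms by (simp add: sigma_step_def)
  then show ?thesis using assms(1) by (simp add: sigma_eq_iff r_into_rtrancl)
qed

section \<open>Countable bases of controlled sets\<close>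

lemma coarse_structureD:
  assumes "coarse_structure X C"
  shows "E \<in> C \<Longrightarrow> E \<subseteq> X \<times> X" "E \<in> C \<Longrightarrow> F \<subseteq> E \<Longrightarrow> F \<in> C"
    "E \<in> C \<Longrightarrow> F \<in> C \<Longrightarrow> E O F \<in> C" "E \<in> C \<Longrightarrow> E\<inverse> \<in> C"
  using assms by (auto simp: coarse_structure_def)

text \<open>This is what the argument takes from a metric: an increasing sequence of reflexive
  symmetric controlled sets that is cofinal. Composites of the \<open>E m\<close> are handled by
  closure of \<open>C\<close> under composition followed by cofinality.\<close>

locale coarse_base =
  fixes X :: "'a set" and C :: "('a \<times> 'a) set set" and \<xi> :: 'a
    and E :: "nat \<Rightarrow> ('a \<times> 'a) set"
  assumes coarse: "coarse_structure X C"
    and base_point: "\<xi> \<in> X"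
    and base_mem: "E m \<in> C"
    and base_mono: "m \<le> n \<Longrightarrow> E m \<subseteq> E n"
    and base_refl: "x \<in> X \<Longrightarrow> (x, x) \<in> E m"
    and base_sym: "(x, y) \<in> E m \<Longrightarrow> (y, x) \<in> E m"
    and base_cofinal: "F \<in> C \<Longrightarrow> \<exists>m. F \<subseteq> E m"

text \<open>The base consists of the relations "at distance at most \<open>m\<close>". Natural radii
  are cofinal since a finite supremum is exceeded by some natural number.\<close>

lemma metrisable_imp_coarse_base:
  assumes "coarse_structure X C" "\<xi> \<in> X" "metrisable X C"
  shows "\<exists>E. coarse_base X C \<xi> E"
proof -
  obtain d where d: "generalised_metric X d" "C = bounded_coarse_structure X d"
    using assms unfolding metrisable_def by blast
  let ?E = "\<lambda>m::nat. {(x, y). x \<in> X \<and> y \<in> X \<and> d x y \<le> of_nat m}"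
  have "coarse_base X C \<xi> ?E"
  proof
    fix m n :: nat and x y
    have "(SUP (x, y)\<in>?E m. d x y) \<le> of_nat m"
      by (intro SUP_least) auto
    then have "(SUP (x, y)\<in>?E m. d x y) < \<infinity>"
      by (rule order_le_less_trans) (simp add: of_nat_less_top)
    then show "?E m \<in> C" unfolding d bounded_coarse_structure_def by blast
    show "?E m \<subseteq> ?E n" if "m \<le> n"
    proof clarify
      fix x y assume "d x y \<le> of_nat m"
      also have "(of_nat m :: ennreal) \<le> of_nat n" using that by simp
      finally show "d x y \<le> of_nat n" .
    qed
    show "(x, x) \<in> ?E m" if "x \<in> X"
    proof -
      have "d x x = 0" using that d(1) by (simp add: generalised_metric_def)
      then show ?thesis using that by simp
    qed
    show "(x, y) \<in> ?E m \<Longrightarrow> (y, x) \<in> ?E m"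
      using d(1) by (simp add: generalised_metric_def)
  next
    fix F assume "F \<in> C"
    then have F: "F \<subseteq> X \<times> X" "(SUP (x, y)\<in>F. d x y) < \<infinity>"
      unfolding d bounded_coarse_structure_def by blast+
    then obtain k :: nat where k: "(SUP (x, y)\<in>F. d x y) < of_nat k"
      using ennreal_Ex_less_of_nat by (metis infinity_ennreal_def)
    have "d x y \<le> of_nat k" if "(x, y) \<in> F" for x y
    proof -
      have "d x y \<le> (SUP (x, y)\<in>F. d x y)"
        using that by (intro SUP_upper2[of "(x, y)"]) auto
      with k show ?thesis by order
    qed
    then have "F \<subseteq> ?E k" using F(1) by auto
    then show "\<exists>m. F \<subseteq> ?E m" by blast
  qed (use assms in auto)
  then show ?thesis by blast
qed

context coarse_base
begin

text \<open>Excluding only \<open>k < r\<close> makes \<open>avoid 0\<close> the whole space, so that paths through the base point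
  are covered by the case \<open>r = 0\<close>.\<close>

definition avoid :: "nat \<Rightarrow> 'a set" where
  "avoid r = {x \<in> X. \<forall>k<r. (x, \<xi>) \<notin> E k}"

text \<open>Paths are taken in the transitive closure, not the reflexive one: this keeps both ends
  in \<open>avoid r\<close>, and constant paths there are still present because \<open>E m\<close>
  is reflexive.\<close>

definition step :: "nat \<Rightarrow> nat \<Rightarrow> ('a \<times> 'a) set" where
  "step m r = E m \<inter> avoid r \<times> avoid r"

text \<open>The step size \<open>m\<close> is chosen before \<open>r\<close>. This uniformity makes
  a concatenation of the connecting paths bornologous.\<close>

definition ends_connected :: "(nat \<Rightarrow> 'a) \<Rightarrow> (nat \<Rightarrow> 'a) \<Rightarrow> bool" where
  "ends_connected s t \<longleftrightarrow> (\<exists>m. \<forall>r. \<exists>K. \<forall>i\<ge>K. \<forall>j\<ge>K. (s i, t j) \<in> (step m r)\<^sup>+)"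

lemma base_subset: "E m \<subseteq> X \<times> X"
  using coarse_structureD(1)[OF coarse base_mem] .

lemma avoid_subset: "avoid r \<subseteq> X"
  by (auto simp: avoid_def)

lemma avoid_antimono: "r \<le> r' \<Longrightarrow> avoid r' \<subseteq> avoid r"
  by (auto simp: avoid_def)

lemma step_trancl_mono: "m \<le> m' \<Longrightarrow> r' \<le> r \<Longrightarrow> (x, y) \<in> (step m r)\<^sup>+ \<Longrightarrow> (x, y) \<in> (step m' r')\<^sup>+"
proof -
  assume "m \<le> m'" "r' \<le> r" "(x, y) \<in> (step m r)\<^sup>+"
  moreover from this have "step m r \<subseteq> step m' r'"
    using base_mono[of m m'] avoid_antimono[of r' r] unfolding step_def by blast
  ultimately show ?thesis by (blast intro: trancl_mono)
qed

lemma step_trancl_sym: "(x, y) \<in> (step m r)\<^sup>+ \<Longrightarrow> (y, x) \<in> (step m r)\<^sup>+"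
proof -
  have "sym (step m r)" unfolding sym_def step_def using base_sym by blast
  then show "(x, y) \<in> (step m r)\<^sup>+ \<Longrightarrow> (y, x) \<in> (step m r)\<^sup>+" by (metis sym_trancl symD)
qed

lemma step_refl: "x \<in> avoid r \<Longrightarrow> (x, x) \<in> step m r"
  unfolding step_def using base_refl avoid_subset by blast

section \<open>Tails of coarse sequences and paths between them\<close>

lemma coarse_seq_eventually_avoids:
  assumes "s \<in> coarse_seqs X C \<xi>"
  shows "\<exists>K. \<forall>i\<ge>K. s i \<in> avoid r"
proof -
  have s: "s \<in> UNIV \<rightarrow> X" "proper_map UNIV nat_coarse X C s"
    using assms unfolding coarse_seqs_def pointed_coarse_map_def by blast+
  have "\<exists>K. \<forall>i\<ge>K. (s i, \<xi>) \<notin> E k" for k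
  proof -
    let ?B = "{x \<in> X. (x, \<xi>) \<in> E k}"
    \<comment> \<open>Any two points of the ball are joined through the base point, so the ball is
      bounded and by properness its preimage has bounded diameter.\<close>
    have "E k O (E k)\<inverse> \<in> C"
      by (intro coarse_structureD(3,4)[OF coarse] base_mem)
    moreover have "?B \<times> ?B \<subseteq> E k O (E k)\<inverse>" by auto
    ultimately have "?B \<times> ?B \<in> C"
      by (rule coarse_structureD(2)[OF coarse])
    then have "coarsely_bounded X C ?B"
      unfolding coarsely_bounded_def by blast
    then have "coarsely_bounded UNIV nat_coarse (s -` ?B \<inter> UNIV)"
      using s(2) unfolding proper_map_def by blast
    then obtain l where l: "\<And>i j. s i \<in> ?B \<Longrightarrow> s j \<in> ?B \<Longrightarrow> i \<le> j + l"
      unfolding coarsely_bounded_def nat_coarse_iff by blast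
    show ?thesis
    proof (cases "\<exists>j. s j \<in> ?B")
      case True
      then obtain j where "s j \<in> ?B" by blast
      then have "\<forall>i\<ge>Suc (j + l). s i \<notin> ?B" using l[of _ j] not_less_eq_eq by blast
      then show ?thesis using s(1) by blast
    next
      case False
      then show ?thesis using s(1) by blast
    qed
  qed
  then obtain K where K: "\<And>k i. i \<ge> K k \<Longrightarrow> (s i, \<xi>) \<notin> E k" by metis
  \<comment> \<open>The sum serves as an upper bound for the finitely many thresholds
    \<open>K k\<close>; it is also defined for \<open>r = 0\<close>.\<close>
  have "s i \<in> avoid r" if "i \<ge> (\<Sum>k<r. K k)" for i
  proof -
    have "K k \<le> i" if "k < r" for k
      using member_le_sum[of k "{..<r}" K] that \<open>i \<ge> _\<close> by simp
    then show ?thesis using K s(1) unfolding avoid_def by blast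
  qed
  then show ?thesis by blast
qed

text \<open>Bornologousness is applied to the controlled set of all pairs of successive
  indices.\<close>

lemma coarse_seq_steps:
  assumes "s \<in> coarse_seqs X C \<xi>"
  shows "\<exists>m. \<forall>i. (s i, s (Suc i)) \<in> E m"
proof -
  have "{(i, Suc i) | i. True} \<in> nat_coarse"
    unfolding nat_coarse_iff by (rule exI[of _ 1]) auto
  then have "map_prod s s ` {(i, Suc i) | i. True} \<in> C"
    using assms unfolding coarse_seqs_def pointed_coarse_map_def bornologous_def by blast
  then obtain m where "map_prod s s ` {(i, Suc i) | i. True} \<subseteq> E m"
    using base_cofinal by blast
  then have "(s i, s (Suc i)) \<in> E m" for i by (auto simp: image_subset_iff)
  then show ?thesis by blast
qed

lemma walk_trancl:
  assumes "\<And>i. K \<le> i \<Longrightarrow> i \<le> k \<Longrightarrow> s i \<in> avoid r" "\<And>i. (s i, s (Suc i)) \<in> E m"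
    "K \<le> k"
  shows "(s K, s k) \<in> (step m r)\<^sup>+"
  using assms(3,1)
proof (induction k rule: dec_induct)
  case base
  then show ?case using step_refl by blast
next
  case (step n)
  then have "(s K, s n) \<in> (local.step m r)\<^sup>+" by simp
  moreover have "(s n, s (Suc n)) \<in> local.step m r"
    using step assms(2) by (simp add: step_def)
  ultimately show ?case by (rule trancl.intros(2))
qed

lemma walk_trancl2:
  assumes "\<And>i. K \<le> i \<Longrightarrow> s i \<in> avoid r" "\<And>i. (s i, s (Suc i)) \<in> E m"
    "K \<le> i" "K \<le> j"
  shows "(s i, s j) \<in> (step m r)\<^sup>+"
proof -
  have "(s K, s i) \<in> (step m r)\<^sup>+" "(s K, s j) \<in> (step m r)\<^sup>+"
    using assms by (auto intro!: walk_trancl)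
  then show ?thesis using step_trancl_sym by (meson trancl_trans)
qed

text \<open>The sequence itself, run between two late indices, is the connecting path.\<close>

lemma ends_connected_refl:
  assumes "s \<in> coarse_seqs X C \<xi>"
  shows "ends_connected s s"
proof -
  obtain m where "\<And>i. (s i, s (Suc i)) \<in> E m" using coarse_seq_steps[OF assms] by blast
  then show ?thesis
    unfolding ends_connected_def
    using walk_trancl2 coarse_seq_eventually_avoids[OF assms] by metis
qed

lemma ends_connected_sym: "ends_connected s t \<Longrightarrow> ends_connected t s"
  unfolding ends_connected_def by (meson step_trancl_sym)

lemma ends_connectedD:
  assumes "ends_connected s t"
  shows "\<exists>m. \<forall>m'\<ge>m. \<forall>r. \<exists>K. \<forall>i\<ge>K. \<forall>j\<ge>K. (s i, t j) \<in> (step m' r)\<^sup>+"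
proof -
  obtain m where m: "\<And>r. \<exists>K. \<forall>i\<ge>K. \<forall>j\<ge>K. (s i, t j) \<in> (step m r)\<^sup>+"
    using assms unfolding ends_connected_def by blast
  have "\<exists>K. \<forall>i\<ge>K. \<forall>j\<ge>K. (s i, t j) \<in> (step m' r)\<^sup>+" if "m \<le> m'" for m' r
    using m[of r] step_trancl_mono[OF that order_refl] by blast
  then show ?thesis by blast
qed

text \<open>One connection beyond each threshold is enough, since it can be prolonged along the
  tails of \<open>s\<close> and \<open>t\<close>, each of which is connected. Downward transfer
  delivers exactly such isolated connections.\<close>

lemma ends_connectedI:
  assumes "s \<in> coarse_seqs X C \<xi>" "t \<in> coarse_seqs X C \<xi>"
    and conn: "\<And>r K. \<exists>i\<ge>K. \<exists>j\<ge>K. (s i, t j) \<in> (step m r)\<^sup>+"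
  shows "ends_connected s t"
proof -
  obtain a where a: "\<And>m' r. a \<le> m' \<Longrightarrow> \<exists>K. \<forall>i\<ge>K. \<forall>j\<ge>K. (s i, s j) \<in> (step m' r)\<^sup>+"
    using ends_connectedD[OF ends_connected_refl[OF assms(1)]] by blast
  obtain b where b: "\<And>m' r. b \<le> m' \<Longrightarrow> \<exists>K. \<forall>i\<ge>K. \<forall>j\<ge>K. (t i, t j) \<in> (step m' r)\<^sup>+"
    using ends_connectedD[OF ends_connected_refl[OF assms(2)]] by blast
  define M where "M = max m (max a b)"
  have M: "m \<le> M" "a \<le> M" "b \<le> M" by (auto simp: M_def)
  have "\<exists>K. \<forall>i\<ge>K. \<forall>j\<ge>K. (s i, t j) \<in> (step M r)\<^sup>+" for r
  proof -
    obtain K where K: "\<forall>i\<ge>K. \<forall>j\<ge>K. (s i, s j) \<in> (step M r)\<^sup>+" using a[OF M(2)] by blast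
    obtain L where L: "\<forall>i\<ge>L. \<forall>j\<ge>L. (t i, t j) \<in> (step M r)\<^sup>+" using b[OF M(3)] by blast
    obtain i j where ij: "i \<ge> max K L" "j \<ge> max K L" "(s i, t j) \<in> (step m r)\<^sup>+"
      using conn[of "max K L" r] by blast
    have "(s i', t j') \<in> (step M r)\<^sup>+" if "i' \<ge> max K L" "j' \<ge> max K L" for i' j'
    proof -
      have "(s i', s i) \<in> (step M r)\<^sup>+" using K ij that by simp
      also have "(s i, t j) \<in> (step M r)\<^sup>+" using step_trancl_mono[OF M(1) order_refl ij(3)] .
      also have "(t j, t j') \<in> (step M r)\<^sup>+" using L ij that by simp
      finally show ?thesis .
    qed
    then show ?thesis by blast
  qed
  then show ?thesis unfolding ends_connected_def by blast
qed

lemma ends_connected_trans: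
  assumes "ends_connected s t" "ends_connected t u"
  shows "ends_connected s u"
proof -
  obtain a where a: "\<And>m' r. a \<le> m' \<Longrightarrow> \<exists>K. \<forall>i\<ge>K. \<forall>j\<ge>K. (s i, t j) \<in> (step m' r)\<^sup>+"
    using ends_connectedD[OF assms(1)] by blast
  obtain b where b: "\<And>m' r. b \<le> m' \<Longrightarrow> \<exists>K. \<forall>i\<ge>K. \<forall>j\<ge>K. (t i, u j) \<in> (step m' r)\<^sup>+"
    using ends_connectedD[OF assms(2)] by blast
  define M where "M = max a b"
  have M: "a \<le> M" "b \<le> M" by (auto simp: M_def)
  have "\<exists>K. \<forall>i\<ge>K. \<forall>j\<ge>K. (s i, u j) \<in> (step M r)\<^sup>+" for r
  proof -
    obtain K where K: "\<forall>i\<ge>K. \<forall>j\<ge>K. (s i, t j) \<in> (step M r)\<^sup>+" using a[OF M(1)] by blast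
    obtain L where L: "\<forall>i\<ge>L. \<forall>j\<ge>L. (t i, u j) \<in> (step M r)\<^sup>+" using b[OF M(2)] by blast
    have "(s i, u j) \<in> (step M r)\<^sup>+" if "i \<ge> max K L" "j \<ge> max K L" for i j
    proof -
      have "(s i, t (max K L)) \<in> (step M r)\<^sup>+" using K that by simp
      also have "(t (max K L), u j) \<in> (step M r)\<^sup>+" using L that by simp
      finally show ?thesis .
    qed
    then show ?thesis by blast
  qed
  then show ?thesis unfolding ends_connected_def by blast
qed

text \<open>A strictly increasing reindexing never lowers an index, so the thresholds that work for
  \<open>t\<close> against itself still work.\<close>

lemma subsequence_imp_ends_connected:
  assumes "t \<in> coarse_seqs X C \<xi>" "subsequence s t"
  shows "ends_connected s t"
proof -
  obtain \<kappa> where \<kappa>: "strict_mono \<kappa>" "s = t \<circ> \<kappa>" using assms by (auto simp: subsequence_def)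
  have mono: "i \<le> \<kappa> i" for i using \<kappa>(1) by (rule strict_mono_imp_increasing)
  obtain m where m: "\<And>r. \<exists>K. \<forall>i\<ge>K. \<forall>j\<ge>K. (t i, t j) \<in> (step m r)\<^sup>+"
    using ends_connected_refl[OF assms(1)] unfolding ends_connected_def by blast
  have "\<exists>K. \<forall>i\<ge>K. \<forall>j\<ge>K. (s i, t j) \<in> (step m r)\<^sup>+" for r
  proof -
    obtain K where "\<forall>i\<ge>K. \<forall>j\<ge>K. (t i, t j) \<in> (step m r)\<^sup>+" using m[of r] by blast
    then have "\<forall>i\<ge>K. \<forall>j\<ge>K. (s i, t j) \<in> (step m r)\<^sup>+"
      unfolding \<kappa>(2) comp_def using mono order_trans by blast
    then show ?thesis by blast
  qed
  then show ?thesis unfolding ends_connected_def by blast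
qed

lemma sigma_eq_imp_ends_connected:
  assumes "(s, t) \<in> sigma_eq X C \<xi>"
  shows "ends_connected s t"
proof -
  have "(s, t) \<in> (sigma_step X C \<xi>)\<^sup>*" and s: "s \<in> coarse_seqs X C \<xi>"
    using assms unfolding sigma_eq_iff by blast+
  then show ?thesis
  proof (induction rule: rtrancl_induct)
    case base
    show ?case using s by (rule ends_connected_refl)
  next
    case (step u v)
    then have "ends_connected u v"
      unfolding sigma_step_def
      using subsequence_imp_ends_connected ends_connected_sym by blast
    with step.IH[OF s] show ?case by (rule ends_connected_trans)
  qed
qed

section \<open>Building coarse sequences from walks\<close>

text \<open>A bounded number of steps composes to one controlled set, uniformly in the starting
  index.\<close>

lemma walk_close:
  assumes "\<And>i. (u i, u (Suc i)) \<in> E m"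
  shows "\<exists>M. \<forall>i. \<forall>j\<le>k. (u i, u (i + j)) \<in> E M"
proof (induction k)
  case 0
  have "u i \<in> X" for i using assms base_subset by blast
  then show ?case using base_refl by simp
next
  case (Suc k)
  then obtain M where M: "\<And>i j. j \<le> k \<Longrightarrow> (u i, u (i + j)) \<in> E M" by blast
  have "E m O E M \<in> C" by (intro coarse_structureD(3)[OF coarse] base_mem)
  then obtain M' where M': "E m O E M \<subseteq> E M'" using base_cofinal by blast
  have "(u i, u (i + j)) \<in> E M'" if "j \<le> Suc k" for i j
  proof (cases j)
    case 0
    have "u i \<in> X" using assms base_subset by blast
    then show ?thesis using 0 base_refl by simp
  next
    case (Suc j')
    then have "(u (Suc i), u (Suc i + j')) \<in> E M" using that M[of j' "Suc i"] by simp
    then have "(u i, u (Suc i + j')) \<in> E m O E M" using assms by blast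
    then show ?thesis using M' Suc by auto
  qed
  then show ?case by blast
qed

text \<open>Uniformly bounded steps make \<open>u\<close> bornologous, and leaving every ball makes
  it proper, since a bounded set that \<open>u\<close> meets lies in some ball around the base
  point.\<close>

lemma coarse_seqI:
  assumes "u 0 = \<xi>" and walk: "\<And>i. (u i, u (Suc i)) \<in> E m"
    and proper: "\<And>r. \<exists>K. \<forall>i\<ge>K. u i \<in> avoid r"
  shows "u \<in> coarse_seqs X C \<xi>"
proof -
  have X: "u i \<in> X" for i using walk base_subset by blast
  have "map_prod u u ` F \<in> C" if F: "F \<in> nat_coarse" for F
  proof -
    obtain k where k: "\<And>i j. (i, j) \<in> F \<Longrightarrow> i \<le> j + k \<and> j \<le> i + k"
      using F unfolding nat_coarse_iff by blast
    obtain M where M: "\<And>i j. j \<le> k \<Longrightarrow> (u i, u (i + j)) \<in> E M"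
      using walk_close[of u m, OF walk] by blast
    have "(u i, u j) \<in> E M" if "(i, j) \<in> F" for i j
    proof (cases "i \<le> j")
      case True
      then show ?thesis using M[of "j - i" i] k[OF that] by simp
    next
      case False
      then have "(u j, u i) \<in> E M" using M[of "i - j" j] k[OF that] by simp
      then show ?thesis by (rule base_sym)
    qed
    then have "map_prod u u ` F \<subseteq> E M" by auto
    with base_mem show ?thesis by (rule coarse_structureD(2)[OF coarse])
  qed
  moreover have "coarsely_bounded UNIV nat_coarse (u -` B \<inter> UNIV)"
    if B: "coarsely_bounded X C B" for B
  proof (cases "\<exists>j. u j \<in> B")
    case True
    then obtain j where j: "u j \<in> B" by blast
    have "B \<times> B \<in> C" using B by (simp add: coarsely_bounded_def)
    then obtain a where a: "B \<times> B \<subseteq> E a" using base_cofinal by blast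
    obtain b where "(u 0, u (0 + j)) \<in> E b" using walk_close[of u m, OF walk] by blast
    then have b: "(u j, \<xi>) \<in> E b" using base_sym assms(1) by simp
    have "E a O E b \<in> C" by (intro coarse_structureD(3)[OF coarse] base_mem)
    then obtain c where c: "E a O E b \<subseteq> E c" using base_cofinal by blast
    have ball: "(x, \<xi>) \<in> E c" if "x \<in> B" for x
      using that a b c j by blast
    \<comment> \<open>The successor is needed because \<open>avoid r\<close> excludes only the
      indices strictly below \<open>r\<close>, and the ball of index \<open>c\<close> is to be
      excluded.\<close>
    obtain K where K: "\<And>i. i \<ge> K \<Longrightarrow> u i \<in> avoid (Suc c)" using proper by blast
    have "i < K" if "u i \<in> B" for i
      using K[of i] ball[OF that] unfolding avoid_def by (cases "i < K") auto
    then have "\<forall>(i, j)\<in>(u -` B) \<times> (u -` B). i \<le> j + K \<and> j \<le> i + K"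
      by (auto intro: less_imp_le trans_le_add2)
    then show ?thesis unfolding coarsely_bounded_def nat_coarse_iff by auto
  next
    case False
    then have "u -` B \<inter> UNIV = {}" by auto
    then show ?thesis by (simp add: coarsely_bounded_def nat_coarse_iff)
  qed
  ultimately show ?thesis
    using assms(1) X
    by (simp add: coarse_seqs_def pointed_coarse_map_def proper_map_def bornologous_def)
qed

lemma avoid_0: "avoid 0 = X"
  by (simp add: avoid_def)

text \<open>The walk \<open>u\<close> runs through the connecting paths one after the other. Their
  common step size bounds its steps, and it is proper because later paths can be chosen outside
  larger balls.\<close>

lemma coarse_seq_concat:
  assumes "z 0 = \<xi>" and conn0: "\<And>n. (z n, z (Suc n)) \<in> (step m 0)\<^sup>+"
    and conn: "\<And>r. \<exists>K. \<forall>n\<ge>K. (z n, z (Suc n)) \<in> (step m r)\<^sup>+"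
  shows "\<exists>u\<in>coarse_seqs X C \<xi>. subsequence z u"
proof -
  define good where "good n r \<longleftrightarrow> r \<le> n \<and> (z n, z (Suc n)) \<in> (step m r)\<^sup>+" for n r
  \<comment> \<open>Letting the \<open>n\<close>-th path avoid the largest radius possible, capped by \<open>n\<close> so that it exists,
    makes the concatenation proper.\<close>
  define \<rho> where "\<rho> n = (GREATEST r. good n r)" for n
  have \<rho>: "(z n, z (Suc n)) \<in> (step m (\<rho> n))\<^sup>+" for n
  proof -
    have "good n 0" using conn0 by (simp add: good_def)
    then have "good n (\<rho> n)"
      unfolding \<rho>_def by (rule GreatestI_nat[where b = n]) (simp add: good_def)
    then show ?thesis by (simp add: good_def)
  qed
  have \<rho>_lim: "\<exists>K. \<forall>n\<ge>K. r \<le> \<rho> n" for r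
  proof -
    obtain K where K: "\<And>n. n \<ge> K \<Longrightarrow> (z n, z (Suc n)) \<in> (step m r)\<^sup>+" using conn by blast
    have "r \<le> \<rho> n" if "n \<ge> max K r" for n
    proof -
      have "good n r" using K that by (simp add: good_def)
      then show ?thesis
        unfolding \<rho>_def by (rule Greatest_le_nat[where b = n]) (simp add: good_def)
    qed
    then show ?thesis by blast
  qed
  \<comment> \<open>Positive lengths make the times at which \<open>u\<close> visits the
    \<open>z n\<close> strictly increasing, as a subsequence requires.\<close>
  have "\<forall>n. \<exists>l f. l > 0 \<and> f 0 = z n \<and> f l = z (Suc n) \<and>
      (\<forall>i<l. (f i, f (Suc i)) \<in> step m (\<rho> n))"
  proof
    fix n
    obtain l where "l > 0" "(z n, z (Suc n)) \<in> step m (\<rho> n) ^^ l"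
      using \<rho>[of n] unfolding trancl_power by blast
    then show "\<exists>l f. l > 0 \<and> f 0 = z n \<and> f l = z (Suc n) \<and>
        (\<forall>i<l. (f i, f (Suc i)) \<in> step m (\<rho> n))"
      unfolding relpow_fun_conv by blast
  qed
  from choice[OF this] obtain l where "\<forall>n. \<exists>f. l n > 0 \<and> f 0 = z n \<and> f (l n) = z (Suc n) \<and>
      (\<forall>i<l n. (f i, f (Suc i)) \<in> step m (\<rho> n))" by blast
  from choice[OF this] obtain p where
    "\<forall>n. l n > 0 \<and> p n 0 = z n \<and> p n (l n) = z (Suc n) \<and>
      (\<forall>i<l n. (p n i, p n (Suc i)) \<in> step m (\<rho> n))" by blast
  then have l: "\<And>n. l n > 0" and p0: "\<And>n. p n 0 = z n"
    and pl: "\<And>n. p n (l n) = z (Suc n)"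
    and p: "\<And>n i. i < l n \<Longrightarrow> (p n i, p n (Suc i)) \<in> step m (\<rho> n)"
    by blast+
  \<comment> \<open>\<open>N n\<close> is the time at which the walk reaches \<open>z n\<close>. The
    \<open>n\<close>-th path occupies the times from \<open>N n\<close> up to, but excluding,
    \<open>N (Suc n)\<close>.\<close>
  define N where "N n = (\<Sum>j<n. l j)" for n :: nat
  have N_Suc: "N (Suc n) = N n + l n" for n by (simp add: N_def)
  have N_mono: "strict_mono N" using l by (simp add: strict_mono_Suc_iff N_Suc)
  have N_block: "\<exists>n. N n \<le> i \<and> i < N (Suc n)" for i
  proof (induction i)
    case 0
    have "N 0 \<le> 0 \<and> 0 < N (Suc 0)" using l by (simp add: N_def)
    then show ?case by blast
  next
    case (Suc i)
    then obtain n where n: "N n \<le> i" "i < N (Suc n)" by blast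
    show ?case
    proof (cases "Suc i < N (Suc n)")
      case True
      then show ?thesis using n by (intro exI[of _ n]) simp
    next
      case False
      then have "Suc i = N (Suc n)" using n by simp
      then show ?thesis using l N_Suc[of "Suc n"] by (intro exI[of _ "Suc n"]) simp
    qed
  qed
  have block_unique: "n = n'" if "N n \<le> i" "i < N (Suc n)" "N n' \<le> i" "i < N (Suc n')" for n n' i
  proof -
    have "N n < N (Suc n')" "N n' < N (Suc n)" using that by linarith+
    then have "n < Suc n'" "n' < Suc n" using strict_mono_less[OF N_mono] by blast+
    then show ?thesis by simp
  qed
  define b where "b i = (SOME n. N n \<le> i \<and> i < N (Suc n))" for i
  have b: "N (b i) \<le> i \<and> i < N (Suc (b i))" for i
    unfolding b_def using N_block by (rule someI_ex)
  define u where "u i = p (b i) (i - N (b i))" for i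
  have u_less: "u (N n + j) = p n j" if "j < l n" for n j
  proof -
    have "b (N n + j) = n"
      using b[of "N n + j"] that by (intro block_unique[of _ "N n + j"]) (auto simp: N_Suc)
    then show ?thesis by (simp add: u_def)
  qed
  have u_N: "u (N n) = z n" for n
    using u_less[of 0 n] l p0 by simp
  \<comment> \<open>The last point of a path belongs to the next block, where it is the first point
    of the next path.\<close>
  have u_le: "u (N n + j) = p n j" if "j \<le> l n" for n j
    using u_less[of j n] u_N[of "Suc n"] that pl by (cases "j = l n") (auto simp: N_Suc)
  have u_step: "(u i, u (Suc i)) \<in> step m (\<rho> (b i))" for i
  proof -
    have "i - N (b i) < l (b i)" using b[of i] by (simp add: N_Suc less_diff_conv2)
    then show ?thesis
      using p[of "i - N (b i)" "b i"] u_le[of "i - N (b i)" "b i"]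
        u_le[of "Suc (i - N (b i))" "b i"] b[of i] by simp
  qed
  have "\<exists>K. \<forall>i\<ge>K. u i \<in> avoid r" for r
  proof -
    obtain K where K: "\<And>n. n \<ge> K \<Longrightarrow> r \<le> \<rho> n" using \<rho>_lim by blast
    have "u i \<in> avoid r" if "i \<ge> N K" for i
    proof -
      have "N K < N (Suc (b i))" using b[of i] that by simp
      then have "K \<le> b i" using strict_mono_less[OF N_mono] by simp
      then have "avoid (\<rho> (b i)) \<subseteq> avoid r" using K avoid_antimono by simp
      then show ?thesis using u_step[of i] by (auto simp: step_def)
    qed
    then show ?thesis by blast
  qed
  moreover have "u 0 = \<xi>" using u_N[of 0] assms(1) by (simp add: N_def)
  moreover have "(u i, u (Suc i)) \<in> E m" for i using u_step[of i] by (simp add: step_def)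
  ultimately have "u \<in> coarse_seqs X C \<xi>" by (intro coarse_seqI)
  moreover have "subsequence z u"
    unfolding subsequence_def using N_mono u_N by (intro exI[of _ N]) (simp add: fun_eq_iff)
  ultimately show ?thesis by blast
qed

lemma subsequence_trans: "subsequence s t \<Longrightarrow> subsequence t u \<Longrightarrow> subsequence s u"
  unfolding subsequence_def by (metis comp_assoc strict_mono_o)

text \<open>The alternating sequence \<open>z\<close> contains both \<open>s\<close> and
  \<open>t\<close>; it need not be coarse, but it is a subsequence of a coarse \<open>u\<close>,
  which links \<open>s\<close> to \<open>t\<close> in two steps.\<close>

lemma ends_connected_imp_sigma_eq:
  assumes s: "s \<in> coarse_seqs X C \<xi>" and t: "t \<in> coarse_seqs X C \<xi>" and "ends_connected s t"
  shows "(s, t) \<in> sigma_eq X C \<xi>"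
proof -
  obtain a where a: "\<And>i. (s i, s (Suc i)) \<in> E a" using coarse_seq_steps[OF s] by blast
  obtain b where b: "\<And>i. (t i, t (Suc i)) \<in> E b" using coarse_seq_steps[OF t] by blast
  obtain c where c: "\<And>m' r. m' \<ge> c \<Longrightarrow> \<exists>K. \<forall>i\<ge>K. \<forall>j\<ge>K. (s i, t j) \<in> (step m' r)\<^sup>+"
    using ends_connectedD[OF assms(3)] by blast
  define m where "m = max a (max b c)"
  have m: "E a \<subseteq> E m" "E b \<subseteq> E m" "c \<le> m" using base_mono by (auto simp: m_def)
  have st0: "s 0 = \<xi>" "t 0 = \<xi>"
    using s t by (auto simp: coarse_seqs_def pointed_coarse_map_def)
  have "s i \<in> avoid 0" "t i \<in> avoid 0" for i
    using a b base_subset by (auto simp: avoid_0)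
  then have "(s i, s 0) \<in> (step m 0)\<^sup>+" "(t 0, t i) \<in> (step m 0)\<^sup>+" for i
    using a b m by (auto intro!: walk_trancl2[where K = 0])
  \<comment> \<open>The path runs back along \<open>s\<close> to the base point and out along
    \<open>t\<close>. It serves the initial indices, where no ball can be avoided.\<close>
  then have conn0: "(s i, t j) \<in> (step m 0)\<^sup>+" for i j
    using st0 by (metis trancl_trans)
  define z where "z n = (if even n then s (n div 2) else t (n div 2))" for n
  have z: "(z n, z (Suc n)) \<in> (step m r)\<^sup>+"
    if "\<And>i j. i \<ge> n div 2 \<Longrightarrow> j \<ge> n div 2 \<Longrightarrow> (s i, t j) \<in> (step m r)\<^sup>+" for n r
  proof (cases "even n")
    case True
    then have "z n = s (n div 2)" "z (Suc n) = t (n div 2)" by (auto simp: z_def)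
    then show ?thesis using that[of "n div 2" "n div 2"] by simp
  next
    case False
    then have "z n = t (n div 2)" "z (Suc n) = s (Suc (n div 2))" by (auto simp: z_def)
    then show ?thesis using step_trancl_sym[OF that[of "Suc (n div 2)" "n div 2"]] by simp
  qed
  have "\<exists>K. \<forall>n\<ge>K. (z n, z (Suc n)) \<in> (step m r)\<^sup>+" for r
  proof -
    obtain K where K: "\<And>i j. i \<ge> K \<Longrightarrow> j \<ge> K \<Longrightarrow> (s i, t j) \<in> (step m r)\<^sup>+"
      using c[OF m(3)] by blast
    \<comment> \<open>Both sequences are traversed at half speed, hence the doubled
      threshold.\<close>
    have "(z n, z (Suc n)) \<in> (step m r)\<^sup>+" if "n \<ge> 2 * K" for n
      by (rule z, rule K) (use that in linarith)+
    then show ?thesis by blast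
  qed
  moreover have "z 0 = \<xi>" using st0 by (simp add: z_def)
  ultimately obtain u where u: "u \<in> coarse_seqs X C \<xi>" "subsequence z u"
    using coarse_seq_concat[of z m] z[OF conn0] by blast
  have "subsequence s z" unfolding subsequence_def
    by (rule exI[of _ "\<lambda>i. 2 * i"]) (auto simp: z_def strict_mono_def)
  then have "(s, u) \<in> sigma_eq X C \<xi>"
    by (intro subsequence_sigma_eq s u subsequence_trans[OF _ u(2)])
  moreover have "subsequence t z" unfolding subsequence_def
    by (rule exI[of _ "\<lambda>i. Suc (2 * i)"]) (auto simp: z_def strict_mono_def)
  then have "(t, u) \<in> sigma_eq X C \<xi>"
    by (intro subsequence_sigma_eq t u subsequence_trans[OF _ u(2)])
  ultimately show ?thesis by (rule sigma_eq_trans[OF _ sigma_eq_sym])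
qed

end

section \<open>Transfer\<close>

definition Disj :: "fm \<Rightarrow> fm \<Rightarrow> fm" where "Disj \<phi> \<psi> = Neg (Conj (Neg \<phi>) (Neg \<psi>))"
definition Imp :: "fm \<Rightarrow> fm \<Rightarrow> fm" where "Imp \<phi> \<psi> = Neg (Conj \<phi> (Neg \<psi>))"
definition Iff :: "fm \<Rightarrow> fm \<Rightarrow> fm" where "Iff \<phi> \<psi> = Conj (Imp \<phi> \<psi>) (Imp \<psi> \<phi>)"
definition Exists :: "nat \<Rightarrow> fm \<Rightarrow> fm" where "Exists i \<phi> = Neg (All i (Neg \<phi>))"

lemma sat_derived [simp]:
  "sat E (Disj \<phi> \<psi>) v \<longleftrightarrow> sat E \<phi> v \<or> sat E \<psi> v"
  "sat E (Imp \<phi> \<psi>) v \<longleftrightarrow> (sat E \<phi> v \<longrightarrow> sat E \<psi> v)"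
  "sat E (Iff \<phi> \<psi>) v \<longleftrightarrow> (sat E \<phi> v \<longleftrightarrow> sat E \<psi> v)"
  "sat E (Exists i \<phi>) v \<longleftrightarrow> (\<exists>a. sat E \<phi> (v(i := a)))"
  by (auto simp: Disj_def Imp_def Iff_def Exists_def)

text \<open>The bound variable exceeds the sum of the arguments, so it is fresh for every choice of
  variables; \<open>Kpair\<close>, \<open>Rel\<close> and \<open>Rel3\<close> use the same
  device.\<close>

definition Doubleton :: "nat \<Rightarrow> nat \<Rightarrow> nat \<Rightarrow> fm" where
  "Doubleton z x y = (let w = Suc (x + y + z) in
     All w (Iff (Mem w z) (Disj (Eq w x) (Eq w y))))"

definition Kpair :: "nat \<Rightarrow> nat \<Rightarrow> nat \<Rightarrow> fm" where
  "Kpair z x y = (let a = Suc (x + y + z); b = Suc a in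
     Exists a (Exists b (Conj (Doubleton a x x) (Conj (Doubleton b x y) (Doubleton z a b)))))"

definition Rel :: "nat \<Rightarrow> nat \<Rightarrow> nat \<Rightarrow> fm" where
  "Rel r x y = (let p = Suc (r + x + y) in Exists p (Conj (Kpair p x y) (Mem p r)))"

definition Rel3 :: "nat \<Rightarrow> nat \<Rightarrow> nat \<Rightarrow> nat \<Rightarrow> fm" where
  "Rel3 r i x y = (let p = Suc (r + i + x + y) in Exists p (Conj (Kpair p x y) (Rel r i p)))"

lemma sat_Doubleton: "sat E (Doubleton z x y) v \<longleftrightarrow> elts E (v z) = {v x, v y}"
  by (simp add: Doubleton_def Let_def elts_def set_eq_iff)

text \<open>Extensionality as a sentence, so that it passes to the nonstandard universe; the next
  lemma does the same for pairing.\<close>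

lemma inj_elts_iff_sat:
  "inj (elts E) \<longleftrightarrow> sat E (All 0 (All 1 (Imp (All 2 (Iff (Mem 2 0) (Mem 2 1))) (Eq 0 1)))) v"
  by (simp add: inj_def elts_def set_eq_iff)

lemma pairing_iff_sat:
  "(\<forall>x y. {x, y} \<in> range (elts E)) \<longleftrightarrow> sat E (All 0 (All 1 (Exists 2 (Doubleton 2 0 1)))) v"
  by (simp add: sat_Doubleton image_iff eq_commute)

text \<open>The common ground of both universes: enough for Kuratowski pairs to work, so formulae
  about pairs are evaluated once for both.\<close>

locale pairing_structure =
  fixes E :: "'u \<Rightarrow> 'u \<Rightarrow> bool"
  assumes ext: "inj (elts E)"
    and pairing: "{x, y} \<in> range (elts E)"
begin

lemma elts_code: "A \<in> range (elts E) \<Longrightarrow> elts E (code E A) = A"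
proof -
  assume "A \<in> range (elts E)"
  then obtain x where x: "elts E x = A" by blast
  then have "(THE x. elts E x = A) = x" using ext by (auto intro!: the_equality dest: injD)
  then show ?thesis using x by (simp add: code_def)
qed

lemma code_elts: "code E (elts E x) = x"
  using ext elts_code[OF rangeI] by (rule injD)

lemma mem_code [simp]: "A \<in> range (elts E) \<Longrightarrow> E x (code E A) \<longleftrightarrow> x \<in> A"
  using elts_code unfolding elts_def by blast

lemma elts_eq_pair: "elts E z = {x, y} \<longleftrightarrow> z = code E {x, y}"
proof
  assume "elts E z = {x, y}"
  then have "code E {x, y} = code E (elts E z)" by simp
  then show "z = code E {x, y}" by (simp only: code_elts)
qed (simp only: elts_code[OF pairing])

lemma code_pair_inject: "code E {x, y} = code E {x', y'} \<longleftrightarrow> {x, y} = {x', y'}"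
proof
  assume "code E {x, y} = code E {x', y'}"
  then have "elts E (code E {x, y}) = elts E (code E {x', y'})" by (rule arg_cong)
  then show "{x, y} = {x', y'}" by (simp only: elts_code[OF pairing])
qed (rule arg_cong)

lemma kpair_eq [simp]: "kpair E a b = kpair E c d \<longleftrightarrow> a = c \<and> b = d"
proof
  assume "kpair E a b = kpair E c d"
  then have "{code E {a, a}, code E {a, b}} = {code E {c, c}, code E {c, d}}"
    unfolding kpair_def insert_absorb2 code_pair_inject .
  then have "{a, a} = {c, c} \<and> {a, b} = {c, d} \<or> {a, a} = {c, d} \<and> {a, b} = {c, c}"
    unfolding doubleton_eq_iff[of "code E {a, a}"] code_pair_inject .
  then show "a = c \<and> b = d" by (auto simp: doubleton_eq_iff)
qed simp

lemma sat_Kpair [simp]: "sat E (Kpair z x y) v \<longleftrightarrow> v z = kpair E (v x) (v y)"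
proof -
  have "sat E (Kpair z x y) v \<longleftrightarrow>
      (\<exists>a b. elts E a = {v x, v x} \<and> elts E b = {v x, v y} \<and> elts E (v z) = {a, b})"
    by (simp add: Kpair_def Let_def sat_Doubleton)
  also have "\<dots> \<longleftrightarrow> v z = code E {code E {v x, v x}, code E {v x, v y}}"
    unfolding elts_eq_pair by blast
  finally show ?thesis by (simp add: kpair_def)
qed

lemma sat_Rel [simp]: "sat E (Rel r x y) v \<longleftrightarrow> E (kpair E (v x) (v y)) (v r)"
  by (simp add: Rel_def Let_def)

lemma sat_Rel3 [simp]: "sat E (Rel3 r i x y) v \<longleftrightarrow> E (kpair E (v i) (kpair E (v x) (v y))) (v r)"
  by (simp add: Rel3_def Let_def)

end

sublocale standard_universe \<subseteq> std: pairing_structure mem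
  by unfold_locales (fact mem_ext mem_pair)+

section \<open>Sets, relations and numerals inside the standard universe\<close>

context standard_universe
begin

definition codable :: "'u set \<Rightarrow> bool" where
  "codable A \<longleftrightarrow> A \<in> range (elts mem)"

definition rel_codable :: "('u \<times> 'u) set \<Rightarrow> bool" where
  "rel_codable R \<longleftrightarrow> codable ((\<lambda>(x, y). kpair mem x y) ` R)"

lemma codable_subset: "codable B \<Longrightarrow> A \<subseteq> B \<Longrightarrow> codable A"
  unfolding codable_def using mem_subset by blast

lemma mem_codable [simp]: "codable A \<Longrightarrow> mem x (code mem A) \<longleftrightarrow> x \<in> A"
  by (simp add: codable_def)

lemma mem_rel_code [simp]:
  "rel_codable R \<Longrightarrow> mem (kpair mem x y) (rel_code mem R) \<longleftrightarrow> (x, y) \<in> R"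
  by (auto simp: rel_codable_def rel_code_def)

lemma codable_times:
  assumes "codable A" "codable B"
  shows "codable ((\<lambda>(x, y). kpair mem x y) ` (A \<times> B))"
  using assms mem_times unfolding codable_def by auto

text \<open>Closure under products and genuine subsets puts every relation between two coded sets
  into the universe; this supplies the parameters of all later transfers.\<close>

lemma rel_codable_subset:
  assumes "codable A" "codable B" "R \<subseteq> A \<times> B"
  shows "rel_codable R"
  unfolding rel_codable_def by (rule codable_subset[OF codable_times[OF assms(1,2)]]) (use assms(3) in blast)

lemma codable_nums [simp]: "codable (range (num mem))"
  using mem_omega by (simp add: codable_def)

lemma elts_num: "elts mem (num mem n) = num mem ` {..<n}"
proof (induction n)
  case 0
  have "codable {}" by (rule codable_subset[OF codable_nums]) simp
  then show ?case by (simp add: std.elts_code codable_def)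
next
  case (Suc n)
  have "codable (insert (num mem n) (elts mem (num mem n)))"
    by (rule codable_subset[OF codable_nums]) (use Suc in auto)
  then have "elts mem (num mem (Suc n)) = insert (num mem n) (num mem ` {..<n})"
    using Suc by (simp add: std.elts_code codable_def)
  then show ?case by (simp add: lessThan_Suc)
qed

declare num.simps [simp del]

text \<open>A smaller numeral is an element of a larger one, and well-foundedness forbids
  self-membership.\<close>

lemma num_eq [simp]: "num mem i = num mem j \<longleftrightarrow> i = j"
proof -
  have "num mem i \<noteq> num mem j" if "i < j" for i j
  proof
    assume "num mem i = num mem j"
    moreover have "num mem i \<in> elts mem (num mem j)" using that by (simp add: elts_num)
    ultimately have "mem (num mem j) (num mem j)" by (simp add: elts_def)
    then show False using mem_wf by (metis wfp_imp_irreflp irreflpD)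
  qed
  then show ?thesis by (metis linorder_neq_iff)
qed

definition nat_le :: "('u \<times> 'u) set" where
  "nat_le = {(num mem i, num mem j) | i j. i \<le> j}"

definition nat_less :: "('u \<times> 'u) set" where
  "nat_less = {(num mem i, num mem j) | i j. i < j}"

definition nat_Suc :: "('u \<times> 'u) set" where
  "nat_Suc = {(num mem i, num mem (Suc i)) | i. True}"

definition seq_graph :: "(nat \<Rightarrow> 'u) \<Rightarrow> ('u \<times> 'u) set" where
  "seq_graph s = {(num mem k, s k) | k. True}"

lemma rel_codable_nat [simp]: "rel_codable nat_le" "rel_codable nat_less" "rel_codable nat_Suc"
  by (rule rel_codable_subset[OF codable_nums codable_nums];
      auto simp: nat_le_def nat_less_def nat_Suc_def)+

lemma rel_codable_seq_graph:
  assumes "codable X" "range s \<subseteq> X"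
  shows "rel_codable (seq_graph s)"
  by (rule rel_codable_subset[OF codable_nums assms(1)]) (use assms(2) in \<open>auto simp: seq_graph_def\<close>)

lemma nat_rel_iff [simp]:
  "(num mem i, num mem j) \<in> nat_le \<longleftrightarrow> i \<le> j"
  "(num mem i, num mem j) \<in> nat_less \<longleftrightarrow> i < j"
  "(num mem i, num mem j) \<in> nat_Suc \<longleftrightarrow> j = Suc i"
  "(num mem i, y) \<in> seq_graph s \<longleftrightarrow> y = s i"
  by (auto simp: nat_le_def nat_less_def nat_Suc_def seq_graph_def)

lemma nat_relE:
  "(x, y) \<in> nat_le \<Longrightarrow> (\<And>i j. x = num mem i \<Longrightarrow> y = num mem j \<Longrightarrow> i \<le> j \<Longrightarrow> P) \<Longrightarrow> P"
  "(x, y) \<in> nat_less \<Longrightarrow> (\<And>i j. x = num mem i \<Longrightarrow> y = num mem j \<Longrightarrow> i < j \<Longrightarrow> P) \<Longrightarrow> P"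
  "(x, y) \<in> nat_Suc \<Longrightarrow> (\<And>i. x = num mem i \<Longrightarrow> y = num mem (Suc i) \<Longrightarrow> P) \<Longrightarrow> P"
  "(x, y) \<in> seq_graph s \<Longrightarrow> (\<And>i. x = num mem i \<Longrightarrow> y = s i \<Longrightarrow> P) \<Longrightarrow> P"
  by (auto simp: nat_le_def nat_less_def nat_Suc_def seq_graph_def)

end

section \<open>Transfer to hypernaturals and star relations\<close>

context nonstandard_setting
begin

text \<open>Variable \<open>k\<close> denotes the \<open>k\<close>-th entry of \<open>ps\<close>,
  which lists the standard parameters. In formulae with parameters the variables from 10 on are kept
  for bound ones.\<close>

lemma transferI: "sat mem \<phi> ((!) ps) \<Longrightarrow> sat nmem \<phi> (star \<circ> (!) ps)"
  by (simp add: elementary)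

lemma transferD: "sat nmem \<phi> (star \<circ> (!) ps) \<Longrightarrow> sat mem \<phi> ((!) ps)"
  by (simp add: elementary)

lemma nmem_pairing: "pairing_structure nmem"
proof
  show "inj (elts nmem)"
    using mem_ext
    unfolding inj_elts_iff_sat[where v = "star \<circ> (!) []"] inj_elts_iff_sat[where v = "(!) []"]
    by (rule transferI)
  have "\<forall>x y. {x, y} \<in> range (elts mem)" using mem_pair by blast
  then have "\<forall>x y. {x, y} \<in> range (elts nmem)"
    unfolding pairing_iff_sat[where v = "star \<circ> (!) []"] pairing_iff_sat[where v = "(!) []"]
    by (rule transferI)
  then show "{x, y} \<in> range (elts nmem)" for x y by blast
qed

end

sublocale nonstandard_setting \<subseteq> ns: pairing_structure nmem
  by (rule nmem_pairing)

context nonstandard_setting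
begin

lemma nmem_star_code [simp]: "nmem a (star (code mem A)) \<longleftrightarrow> a \<in> star_set A"
  by (simp add: star_set_def elts_def)

lemma nmem_star_rel_code [simp]:
  "nmem (kpair nmem a b) (star (rel_code mem R)) \<longleftrightarrow> (a, b) \<in> star_rel R"
  by (simp add: star_rel_def elts_def)

lemma star_set_star [simp]: "codable A \<Longrightarrow> star x \<in> star_set A \<longleftrightarrow> x \<in> A"
  using elementary[of "Mem 0 1" "(!) [x, code mem A]"] by simp

lemma star_rel_star [simp]: "rel_codable R \<Longrightarrow> (star x, star y) \<in> star_rel R \<longleftrightarrow> (x, y) \<in> R"
  using elementary[of "Rel 0 1 2" "(!) [rel_code mem R, x, y]"] by simp

lemma star_set_mono:
  assumes "codable A" "codable B" "A \<subseteq> B"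
  shows "star_set A \<subseteq> star_set B"
proof -
  have "sat nmem (All 10 (Imp (Mem 10 0) (Mem 10 1))) (star \<circ> (!) [code mem A, code mem B])"
    by (rule transferI) (use assms in auto)
  then show ?thesis by auto
qed

lemma star_rel_mono:
  assumes "rel_codable R" "rel_codable S" "R \<subseteq> S"
  shows "star_rel R \<subseteq> star_rel S"
proof -
  have "sat nmem (All 10 (All 11 (Imp (Rel 0 10 11) (Rel 1 10 11))))
      (star \<circ> (!) [rel_code mem R, rel_code mem S])"
    by (rule transferI) (use assms in auto)
  then show ?thesis by auto
qed

lemma star_rel_subset:
  assumes "codable A" "codable B" "R \<subseteq> A \<times> B"
  shows "star_rel R \<subseteq> star_set A \<times> star_set B"
proof -
  have "rel_codable R" using assms by (rule rel_codable_subset)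
  then have "sat nmem (All 10 (All 11 (Imp (Rel 0 10 11) (Conj (Mem 10 1) (Mem 11 2)))))
      (star \<circ> (!) [rel_code mem R, code mem A, code mem B])"
    by (intro transferI) (use assms in auto)
  then show ?thesis by auto
qed

lemma hypernat_relations:
  "hyper_le = star_rel nat_le" "hyper_less = star_rel nat_less" "hyper_Suc = star_rel nat_Suc"
  by (simp_all add: hyper_le_def hyper_less_def hyper_Suc_def nat_le_def nat_less_def nat_Suc_def)

lemma hyper_le_hypernats: "(i, j) \<in> hyper_le \<Longrightarrow> i \<in> hypernats \<and> j \<in> hypernats"
  using star_rel_subset[OF codable_nums codable_nums, of nat_le]
  by (auto simp: hypernat_relations hypernats_def nat_le_def)

lemma num_mem_hypernats [simp]: "star (num mem k) \<in> hypernats"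
  by (simp add: hypernats_def)

lemma zero_hyper_le:
  assumes "i \<in> hypernats"
  shows "(star (num mem 0), i) \<in> hyper_le"
proof -
  have "sat nmem (All 10 (Imp (Mem 10 0) (Rel 1 2 10)))
      (star \<circ> (!) [code mem (range (num mem)), rel_code mem nat_le, num mem 0])"
    by (rule transferI) auto
  then show ?thesis using assms by (simp add: hypernat_relations hypernats_def )
qed

lemma hyper_le_refl:
  assumes "i \<in> hypernats"
  shows "(i, i) \<in> hyper_le"
proof -
  have "sat nmem (All 10 (Imp (Mem 10 0) (Rel 1 10 10)))
      (star \<circ> (!) [code mem (range (num mem)), rel_code mem nat_le])"
    by (rule transferI) auto
  then show ?thesis using assms by (simp add: hypernat_relations hypernats_def)
qed

lemma hyper_le_trans:
  assumes "(i, j) \<in> hyper_le" "(j, k) \<in> hyper_le"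
  shows "(i, k) \<in> hyper_le"
proof -
  have "sat nmem (All 10 (All 11 (All 12 (Imp (Rel 0 10 11) (Imp (Rel 0 11 12) (Rel 0 10 12))))))
      (star \<circ> (!) [rel_code mem nat_le])"
    by (rule transferI) (auto elim!: nat_relE)
  then show ?thesis using assms by (simp add: hypernat_relations)
qed

lemma hyper_Suc_le:
  assumes "(star (num mem k), i) \<in> hyper_le" "i \<noteq> star (num mem k)"
  shows "(star (num mem (Suc k)), i) \<in> hyper_le"
proof -
  have "sat nmem (All 10 (Imp (Rel 0 1 10) (Disj (Eq 10 1) (Rel 0 2 10))))
      (star \<circ> (!) [rel_code mem nat_le, num mem k, num mem (Suc k)])"
    by (rule transferI) (auto elim!: nat_relE)
  then show ?thesis using assms by (simp add: hypernat_relations ) blast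
qed

text \<open>External induction on \<open>k\<close>: an infinite \<open>i\<close> differs from each
  standard numeral, so each bound improves by one.\<close>

lemma infinite_hypernat_ge:
  assumes "i \<in> infinite_hypernats"
  shows "(star (num mem k), i) \<in> hyper_le"
proof (induction k)
  case 0
  show ?case using assms by (intro zero_hyper_le) (simp add: infinite_hypernats_def)
next
  case (Suc k)
  have "i \<noteq> star (num mem k)" using assms by (auto simp: infinite_hypernats_def)
  with Suc show ?case by (rule hyper_Suc_le)
qed

lemma hyper_step_le:
  assumes "(i, n) \<in> hyper_less" "(i, j) \<in> hyper_Suc"
  shows "(i, n) \<in> hyper_le" "(j, n) \<in> hyper_le"
proof -
  have "sat nmem (All 10 (All 11 (All 12 (Imp (Rel 1 10 12) (Imp (Rel 2 10 11)
      (Conj (Rel 0 10 12) (Rel 0 11 12)))))))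
      (star \<circ> (!) [rel_code mem nat_le, rel_code mem nat_less, rel_code mem nat_Suc])"
    by (rule transferI) (auto elim!: nat_relE)
  then show "(i, n) \<in> hyper_le" "(j, n) \<in> hyper_le"
    using assms by (auto simp add: hypernat_relations)
qed

lemma hyper_Suc_unique:
  assumes "(i, j) \<in> hyper_Suc" "(i, k) \<in> hyper_Suc"
  shows "j = k"
proof -
  have "sat nmem (All 10 (All 11 (All 12 (Imp (Rel 0 10 11) (Imp (Rel 0 10 12) (Eq 11 12))))))
      (star \<circ> (!) [rel_code mem nat_Suc])"
    by (rule transferI) (auto elim!: nat_relE)
  then show ?thesis using assms by (simp add: hypernat_relations)
qed

section \<open>Saturation and infinite hypernaturals\<close>

text \<open>In a decreasing sequence of nonempty internal sets, every finite subfamily contains a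
  later member in its intersection.\<close>

lemma countable_saturation:
  assumes nonempty: "\<And>k. \<exists>x. nmem x (F k)"
    and decreasing: "\<And>k l x. k \<le> l \<Longrightarrow> nmem x (F l) \<Longrightarrow> nmem x (F k)"
  shows "\<exists>x. \<forall>k::nat. nmem x (F k)"
proof -
  \<comment> \<open>Saturation speaks of families indexed by the elements of a standard set, so the
    indices are moved to the numerals.\<close>
  define G where "G j = F (inv (num mem) j)" for j
  have inv: "inv (num mem) (num mem k) = k" for k by (rule inv_f_f) (simp add: inj_def)
  have "(\<Inter>j\<in>elts mem (code mem (range (num mem))). elts nmem (G j)) \<noteq> {}"
  proof (rule saturated)
    fix J assume "finite J" and "J \<subseteq> elts mem (code mem (range (num mem)))"
    then have "J \<subseteq> range (num mem)" by (auto simp: elts_def)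
    then obtain K where K: "J = num mem ` K" by (auto simp: subset_image_iff)
    then have "finite K" using \<open>finite J\<close> by (simp add: finite_image_iff inj_on_def)
    then obtain l where l: "\<And>k. k \<in> K \<Longrightarrow> k \<le> l" unfolding finite_nat_set_iff_bounded_le by blast
    obtain x where "nmem x (F l)" using nonempty by blast
    then have "x \<in> (\<Inter>j\<in>J. elts nmem (G j))"
      using decreasing[OF l] by (simp add: K G_def inv elts_def)
    then show "(\<Inter>j\<in>J. elts nmem (G j)) \<noteq> {}" by blast
  qed
  then show ?thesis by (auto simp: elts_def G_def inv)
qed

text \<open>A point common to the stars of all tails of the natural numbers is infinite.\<close>

lemma infinite_hypernats_nonempty: "infinite_hypernats \<noteq> {}"
proof -
  have codable: "codable (num mem ` {k..})" for k :: nat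
    by (rule codable_subset[OF codable_nums]) blast
  have "\<exists>x. \<forall>k::nat. nmem x (star (code mem (num mem ` {k..})))"
  proof (rule countable_saturation)
    fix k :: nat
    have "star (num mem k) \<in> star_set (num mem ` {k..})" using codable by simp
    then show "\<exists>x. nmem x (star (code mem (num mem ` {k..})))" by auto
  next
    fix k l :: nat and x
    assume "k \<le> l" "nmem x (star (code mem (num mem ` {l..})))"
    then show "nmem x (star (code mem (num mem ` {k..})))"
      using star_set_mono[OF codable codable, of l k] image_mono[of "{l..}" "{k..}" "num mem"]
      by auto
  qed
  then obtain x where x: "\<And>k::nat. x \<in> star_set (num mem ` {k..})" by auto
  have "x \<noteq> star (num mem n)" for n
    using x[of "Suc n"] codable[of "Suc n"] by auto
  moreover have "x \<in> hypernats"
    using x[of 0] by (simp add: hypernats_def atLeast_0)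
  ultimately show ?thesis by (auto simp: infinite_hypernats_def)
qed

text \<open>Transfer of "the graph is single-valued and total" justifies the definite description in
  \<open>star_seq\<close>.\<close>

lemma star_seq_graph:
  assumes "codable X" "range s \<subseteq> X" "i \<in> hypernats"
  shows "(i, star_seq s i) \<in> star_rel (seq_graph s)"
proof -
  have "sat nmem (All 10 (Imp (Mem 10 0) (Exists 11 (Conj (Rel 1 10 11)
      (All 12 (Imp (Rel 1 10 12) (Eq 12 11)))))))
      (star \<circ> (!) [code mem (range (num mem)), rel_code mem (seq_graph s)])"
    by (rule transferI) (use rel_codable_seq_graph[OF assms(1,2)] in auto)
  then have "\<exists>y. (i, y) \<in> star_rel (seq_graph s) \<and>
      (\<forall>z. (i, z) \<in> star_rel (seq_graph s) \<longrightarrow> z = y)"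
    using assms(3) by (simp add: hypernats_def)
  then have "\<exists>!y. (i, y) \<in> star_rel (seq_graph s)" by blast
  then show ?thesis unfolding star_seq_def seq_graph_def[symmetric] by (rule theI')
qed

end

section \<open>Internal paths\<close>

text \<open>\<open>g\<close> codes the graph of a path \<open>{i. i \<le> n} \<rightarrow> A r\<close> from \<open>a\<close> to \<open>b\<close> with steps in \<open>S\<close>, where \<open>A r\<close> is
  the set of \<open>y\<close> with \<open>(y, r) \<in> A\<close>.\<close>

definition internal_path ::
  "('w \<Rightarrow> 'w \<Rightarrow> bool) \<Rightarrow> ('w \<times> 'w) set \<Rightarrow> ('w \<times> 'w) set \<Rightarrow> ('w \<times> 'w) set \<Rightarrow> 'w \<Rightarrow>
    ('w \<times> 'w) set \<Rightarrow> ('w \<times> 'w) set \<Rightarrow> 'w \<Rightarrow> 'w \<Rightarrow> 'w \<Rightarrow> 'w \<Rightarrow> 'w \<Rightarrow> bool" where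
  "internal_path E le lt suc zero A S r a b n g \<longleftrightarrow>
     (\<forall>p. E p g \<longrightarrow> (\<exists>i y. p = kpair E i y \<and> (i, n) \<in> le)) \<and>
     (\<forall>i. (i, n) \<in> le \<longrightarrow> (\<exists>y. E (kpair E i y) g \<and> (y, r) \<in> A \<and>
        (\<forall>z. E (kpair E i z) g \<longrightarrow> z = y))) \<and>
     (\<forall>i j y z. (i, n) \<in> lt \<longrightarrow> (i, j) \<in> suc \<longrightarrow>
        E (kpair E i y) g \<longrightarrow> E (kpair E j z) g \<longrightarrow> (y, z) \<in> S) \<and>
     E (kpair E zero a) g \<and> E (kpair E n b) g"

lemma internal_pathI:
  assumes "\<And>p. E p g \<Longrightarrow> \<exists>i y. p = kpair E i y \<and> (i, n) \<in> le"
    and "\<And>i. (i, n) \<in> le \<Longrightarrow> \<exists>y. E (kpair E i y) g \<and> (y, r) \<in> A \<and>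
        (\<forall>z. E (kpair E i z) g \<longrightarrow> z = y)"
    and "\<And>i j y z. (i, n) \<in> lt \<Longrightarrow> (i, j) \<in> suc \<Longrightarrow>
        E (kpair E i y) g \<Longrightarrow> E (kpair E j z) g \<Longrightarrow> (y, z) \<in> S"
    and "E (kpair E zero a) g" and "E (kpair E n b) g"
  shows "internal_path E le lt suc zero A S r a b n g"
  unfolding internal_path_def using assms by blast

lemma internal_pathD:
  assumes "internal_path E le lt suc zero A S r a b n g"
  shows "E p g \<Longrightarrow> \<exists>i y. p = kpair E i y \<and> (i, n) \<in> le"
    and "(i, n) \<in> le \<Longrightarrow> \<exists>y. E (kpair E i y) g \<and> (y, r) \<in> A \<and>
        (\<forall>z. E (kpair E i z) g \<longrightarrow> z = y)"
    and "(i, n) \<in> lt \<Longrightarrow> (i, j) \<in> suc \<Longrightarrow>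
        E (kpair E i y) g \<Longrightarrow> E (kpair E j z) g \<Longrightarrow> (y, z) \<in> S"
    and "E (kpair E zero a) g" and "E (kpair E n b) g"
  using assms unfolding internal_path_def by simp_all

text \<open>Variables 0 to 5 hold the codes of the parameters of \<open>internal_path\<close> in order, variables 10
  to 14 hold \<open>r\<close>, \<open>a\<close>, \<open>b\<close>, \<open>n\<close>, \<open>g\<close>. The path \<open>g\<close> is quantified over the whole universe, as the
  set of all finite sequences in \<open>X\<close> need not belong to it.\<close>

definition Path :: fm where
  "Path = Conj (All 15 (Imp (Mem 15 14) (Exists 16 (Exists 17 (Conj (Kpair 15 16 17) (Rel 0 16 13))))))
     (Conj (All 15 (Imp (Rel 0 15 13) (Exists 16 (Conj (Rel 14 15 16) (Conj (Rel 4 16 10)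
        (All 17 (Imp (Rel 14 15 17) (Eq 17 16))))))))
     (Conj (All 15 (All 16 (All 17 (All 18 (Imp (Rel 1 15 13) (Imp (Rel 2 15 16)
        (Imp (Rel 14 15 17) (Imp (Rel 14 16 18) (Rel 5 17 18)))))))))
     (Conj (Rel 14 3 11) (Rel 14 13 12))))"

text \<open>The relations are arbitrary ones represented by the parameters, so the same formula can
  be read in either universe.\<close>

lemma (in pairing_structure) sat_Path:
  assumes "\<And>x y. E (kpair E x y) (v 0) \<longleftrightarrow> (x, y) \<in> le"
    and "\<And>x y. E (kpair E x y) (v 1) \<longleftrightarrow> (x, y) \<in> lt"
    and "\<And>x y. E (kpair E x y) (v 2) \<longleftrightarrow> (x, y) \<in> suc"
    and "\<And>x y. E (kpair E x y) (v 4) \<longleftrightarrow> (x, y) \<in> A"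
    and "\<And>x y. E (kpair E x y) (v 5) \<longleftrightarrow> (x, y) \<in> S"
  shows "sat E Path v \<longleftrightarrow> internal_path E le lt suc (v 3) A S (v 10) (v 11) (v 12) (v 13) (v 14)"
  by (simp add: Path_def internal_path_def assms[unfolded One_nat_def])

section \<open>Connectedness and points at infinity after transfer\<close>

locale nonstandard_base =
  nonstandard_setting mem nmem star Cat + coarse_base X C \<xi> E
  for mem :: "'u \<Rightarrow> 'u \<Rightarrow> bool" and nmem :: "'v \<Rightarrow> 'v \<Rightarrow> bool" and star Cat
    and X :: "'u set" and C \<xi> E +
  assumes in_Cat: "(X, C, \<xi>) \<in> Cat"
begin

definition avoid_rel :: "('u \<times> 'u) set" where
  "avoid_rel = {(x, num mem r) | x r. x \<in> avoid r}"

text \<open>Keeping \<open>r\<close> as an argument of the relation, rather than as a parameter, is what allows infinite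
  values of \<open>r\<close> after transfer.\<close>

definition conn_rel :: "nat \<Rightarrow> ('u \<times> 'u) set" where
  "conn_rel m = {(num mem r, kpair mem x y) | r x y. (x, y) \<in> (step m r)\<^sup>+}"

definition star_conn :: "nat \<Rightarrow> nat \<Rightarrow> 'v \<Rightarrow> 'v \<Rightarrow> bool" where
  "star_conn m r a b \<longleftrightarrow> (star (num mem r), kpair nmem a b) \<in> star_rel (conn_rel m)"

lemma codable_X [simp]: "codable X"
  using Cat_elements[OF in_Cat] by (simp add: codable_def)

lemma rel_codable_X: "R \<subseteq> X \<times> X \<Longrightarrow> rel_codable R"
  by (rule rel_codable_subset[OF codable_X codable_X])

lemma rel_codable_base [simp]: "rel_codable (E m)"
  by (rule rel_codable_X[OF base_subset])

lemma avoid_rel_iff [simp]: "(x, num mem r) \<in> avoid_rel \<longleftrightarrow> x \<in> avoid r"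
  by (auto simp: avoid_rel_def)

lemma avoid_rel_subset: "avoid_rel \<subseteq> X \<times> range (num mem)"
  using avoid_subset by (auto simp: avoid_rel_def)

lemma rel_codable_avoid [simp]: "rel_codable avoid_rel"
  by (rule rel_codable_subset[OF codable_X codable_nums avoid_rel_subset])

lemma step_trancl_subset: "(step m r)\<^sup>+ \<subseteq> X \<times> X"
  by (rule trancl_subset_Sigma) (use base_subset in \<open>auto simp: step_def\<close>)

lemma conn_rel_iff [simp]:
  "(num mem r, kpair mem x y) \<in> conn_rel m \<longleftrightarrow> (x, y) \<in> (step m r)\<^sup>+"
  by (auto simp: conn_rel_def)

lemma conn_relE:
  assumes "(i, p) \<in> conn_rel m"
  obtains r x y where "i = num mem r" "p = kpair mem x y" "(x, y) \<in> (step m r)\<^sup>+"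
  using assms by (auto simp: conn_rel_def)

lemma rel_codable_conn [simp]: "rel_codable (conn_rel m)"
proof (rule rel_codable_subset[OF codable_nums codable_times[OF codable_X codable_X]])
  show "conn_rel m \<subseteq> range (num mem) \<times> (\<lambda>(x, y). kpair mem x y) ` (X \<times> X)"
    using step_trancl_subset by (force elim!: conn_relE)
qed

lemma finitely_close_iff: "finitely_close C a b \<longleftrightarrow> (\<exists>m. (a, b) \<in> star_rel (E m))"
proof
  assume "finitely_close C a b"
  then obtain F where F: "F \<in> C" "(a, b) \<in> star_rel F" by (auto simp: finitely_close_def)
  then obtain m where m: "F \<subseteq> E m" using base_cofinal by blast
  have "rel_codable F" by (rule rel_codable_X[OF coarse_structureD(1)[OF coarse F(1)]])
  then have "star_rel F \<subseteq> star_rel (E m)" by (rule star_rel_mono) (use m in simp_all)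
  then show "\<exists>m. (a, b) \<in> star_rel (E m)" using F by blast
qed (use base_mem in \<open>auto simp: finitely_close_def\<close>)

lemma star_base_mono: "m \<le> m' \<Longrightarrow> star_rel (E m) \<subseteq> star_rel (E m')"
  by (intro star_rel_mono rel_codable_base base_mono)

text \<open>External induction on the standard index \<open>r\<close>, so that each transfer
  involves only the single relation \<open>E r\<close> instead of the whole sequence
  \<open>E\<close>.\<close>

lemma star_avoid_iff:
  "(x, star (num mem r)) \<in> star_rel avoid_rel \<longleftrightarrow>
     x \<in> star_set X \<and> (\<forall>k<r. (x, star \<xi>) \<notin> star_rel (E k))"
proof (induction r)
  case 0
  have "sat nmem (All 10 (Iff (Rel 0 10 1) (Mem 10 2)))
      (star \<circ> (!) [rel_code mem avoid_rel, num mem 0, code mem X])"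
    by (rule transferI) (auto simp: avoid_0)
  then show ?case by simp
next
  case (Suc r)
  have "sat nmem (All 10 (Iff (Rel 0 10 2) (Conj (Rel 0 10 1) (Neg (Rel 3 10 4)))))
      (star \<circ> (!) [rel_code mem avoid_rel, num mem r, num mem (Suc r), rel_code mem (E r), \<xi>])"
    by (rule transferI) (auto simp: avoid_def less_Suc_eq)
  then show ?case using Suc by (auto simp: less_Suc_eq)
qed

lemma INF_points_iff:
  "a \<in> INF_points X C \<xi> \<longleftrightarrow> (\<forall>r. (a, star (num mem r)) \<in> star_rel avoid_rel)"
  unfolding INF_points_def finitely_close_iff star_avoid_iff by blast

lemma coarse_seq_range: "s \<in> coarse_seqs X C \<xi> \<Longrightarrow> range s \<subseteq> X"
  by (auto simp: coarse_seqs_def pointed_coarse_map_def)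

text \<open>For standard \<open>r\<close> the sequence stays in \<open>avoid r\<close> beyond a
  standard threshold, and every infinite index lies beyond it.\<close>

lemma star_seq_INF:
  assumes s: "s \<in> coarse_seqs X C \<xi>" and i: "i \<in> infinite_hypernats"
  shows "star_seq s i \<in> INF_points X C \<xi>"
  unfolding INF_points_iff
proof
  fix r
  note range = coarse_seq_range[OF s]
  obtain K where K: "\<And>i. i \<ge> K \<Longrightarrow> s i \<in> avoid r"
    using coarse_seq_eventually_avoids[OF s] by blast
  have "sat nmem (All 10 (All 11 (Imp (Rel 0 1 10) (Imp (Rel 2 10 11) (Rel 3 11 4)))))
      (star \<circ> (!) [rel_code mem nat_le, num mem K, rel_code mem (seq_graph s),
        rel_code mem avoid_rel, num mem r])"
    by (rule transferI)
      (use K rel_codable_seq_graph[OF codable_X range] in \<open>auto elim!: nat_relE\<close>)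
  moreover have "(star (num mem K), i) \<in> star_rel nat_le"
    using infinite_hypernat_ge[OF i] by (simp add: hypernat_relations)
  moreover have "(i, star_seq s i) \<in> star_rel (seq_graph s)"
    using i by (intro star_seq_graph[OF codable_X range]) (simp add: infinite_hypernats_def)
  ultimately show "(star_seq s i, star (num mem r)) \<in> star_rel avoid_rel" by simp
qed

lemma star_conn_sym: "star_conn m r a b \<Longrightarrow> star_conn m r b a"
proof -
  have "sat nmem (All 10 (All 11 (Imp (Rel3 0 1 10 11) (Rel3 0 1 11 10))))
      (star \<circ> (!) [rel_code mem (conn_rel m), num mem r])"
    by (rule transferI) (use step_trancl_sym in simp)
  then show "star_conn m r a b \<Longrightarrow> star_conn m r b a" by (simp add: star_conn_def)
qed

lemma star_conn_trans: "star_conn m r a b \<Longrightarrow> star_conn m r b c \<Longrightarrow> star_conn m r a c"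
proof -
  have "sat nmem (All 10 (All 11 (All 12 (Imp (Rel3 0 1 10 11) (Imp (Rel3 0 1 11 12)
      (Rel3 0 1 10 12)))))) (star \<circ> (!) [rel_code mem (conn_rel m), num mem r])"
    by (rule transferI) (simp, blast intro: trancl_trans)
  then show "star_conn m r a b \<Longrightarrow> star_conn m r b c \<Longrightarrow> star_conn m r a c"
    by (simp add: star_conn_def)
qed

lemma star_conn_mono:
  assumes "m \<le> m'" "star_conn m r a b"
  shows "star_conn m' r a b"
proof -
  have "conn_rel m \<subseteq> conn_rel m'"
    using step_trancl_mono[OF assms(1) order_refl] by (auto elim!: conn_relE)
  then have "star_rel (conn_rel m) \<subseteq> star_rel (conn_rel m')"
    by (intro star_rel_mono rel_codable_conn)
  then show ?thesis using assms(2) by (auto simp: star_conn_def)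
qed

lemma star_conn_seqI:
  assumes s: "range s \<subseteq> X" and t: "range t \<subseteq> X"
    and K: "\<forall>i\<ge>K. \<forall>j\<ge>K. (s i, t j) \<in> (step m r)\<^sup>+"
    and i: "i \<in> infinite_hypernats" and j: "j \<in> infinite_hypernats"
  shows "star_conn m r (star_seq s i) (star_seq t j)"
proof -
  have "sat nmem (All 10 (All 11 (All 12 (All 13 (Imp (Conj (Conj (Rel 0 1 10) (Rel 0 1 11))
      (Conj (Rel 2 10 12) (Rel 3 11 13))) (Rel3 4 5 12 13))))))
      (star \<circ> (!) [rel_code mem nat_le, num mem K, rel_code mem (seq_graph s),
        rel_code mem (seq_graph t), rel_code mem (conn_rel m), num mem r])"
    by (rule transferI)
      (use K rel_codable_seq_graph[OF codable_X s] rel_codable_seq_graph[OF codable_X t]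
       in \<open>auto elim!: nat_relE\<close>)
  moreover have "(star (num mem K), i) \<in> star_rel nat_le" "(star (num mem K), j) \<in> star_rel nat_le"
    using infinite_hypernat_ge i j by (simp_all add: hypernat_relations)
  moreover have "(i, star_seq s i) \<in> star_rel (seq_graph s)"
    using i by (intro star_seq_graph[OF codable_X s]) (simp add: infinite_hypernats_def)
  moreover have "(j, star_seq t j) \<in> star_rel (seq_graph t)"
    using j by (intro star_seq_graph[OF codable_X t]) (simp add: infinite_hypernats_def)
  ultimately show ?thesis by (simp add: star_conn_def)
qed

text \<open>The infinite indices witness, in the nonstandard universe, that connected indices beyond
  the standard \<open>K\<close> exist; this existence transfers back.\<close>

lemma star_conn_seqD:
  assumes s: "range s \<subseteq> X" and t: "range t \<subseteq> X"
    and i: "i \<in> infinite_hypernats" and j: "j \<in> infinite_hypernats"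
    and conn: "star_conn m r (star_seq s i) (star_seq t j)"
  shows "\<exists>i\<ge>K. \<exists>j\<ge>K. (s i, t j) \<in> (step m r)\<^sup>+"
proof -
  have "sat mem (Exists 10 (Exists 11 (Exists 12 (Exists 13 (Conj (Conj (Conj (Rel 0 1 10) (Rel 0 1 11))
      (Conj (Rel 2 10 12) (Rel 3 11 13))) (Rel3 4 5 12 13))))))
      ((!) [rel_code mem nat_le, num mem K, rel_code mem (seq_graph s),
        rel_code mem (seq_graph t), rel_code mem (conn_rel m), num mem r])"
  proof (rule transferD)
    have "(star (num mem K), i) \<in> star_rel nat_le" "(star (num mem K), j) \<in> star_rel nat_le"
      using infinite_hypernat_ge i j by (simp_all add: hypernat_relations)
    moreover have "(i, star_seq s i) \<in> star_rel (seq_graph s)"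
      using i by (intro star_seq_graph[OF codable_X s]) (simp add: infinite_hypernats_def)
    moreover have "(j, star_seq t j) \<in> star_rel (seq_graph t)"
      using j by (intro star_seq_graph[OF codable_X t]) (simp add: infinite_hypernats_def)
    ultimately show "sat nmem (Exists 10 (Exists 11 (Exists 12 (Exists 13 (Conj (Conj (Conj (Rel 0 1 10)
      (Rel 0 1 11)) (Conj (Rel 2 10 12) (Rel 3 11 13))) (Rel3 4 5 12 13))))))
      (star \<circ> (!) [rel_code mem nat_le, num mem K, rel_code mem (seq_graph s),
        rel_code mem (seq_graph t), rel_code mem (conn_rel m), num mem r])"
      using conn by (auto simp: star_conn_def)
  qed
  then show ?thesis
    using rel_codable_seq_graph[OF codable_X s] rel_codable_seq_graph[OF codable_X t]
    by (auto elim!: nat_relE) blast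
qed

section \<open>Hyperfinite paths and transferred connectedness\<close>

text \<open>Makes the transitive closure first-order: a finite path is replaced by its graph, an
  element of the universe, so that transfer produces hyperfinite internal paths.\<close>

lemma trancl_iff_internal_path:
  "(x, y) \<in> (step m r)\<^sup>+ \<longleftrightarrow> (\<exists>n\<in>range (num mem). \<exists>g.
     internal_path mem nat_le nat_less nat_Suc (num mem 0) avoid_rel (E m) (num mem r) x y n g)"
proof
  assume "(x, y) \<in> (step m r)\<^sup>+"
  then obtain l where "l > 0" "(x, y) \<in> step m r ^^ l" unfolding trancl_power by blast
  then obtain f where f: "f 0 = x" "f l = y" "\<And>i. i < l \<Longrightarrow> (f i, f (Suc i)) \<in> step m r"
    unfolding relpow_fun_conv by blast
  \<comment> \<open>The last point is the target of the last step, which exists because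
    \<open>l > 0\<close>.\<close>
  have avoid: "f i \<in> avoid r" if "i \<le> l" for i
  proof (cases "i = l")
    case True
    then show ?thesis using f(3)[of "l - 1"] \<open>l > 0\<close> by (simp add: step_def)
  next
    case False
    then show ?thesis using f(3)[of i] that by (simp add: step_def)
  qed
  define R where "R = {(num mem i, f i) | i. i \<le> l}"
  have "rel_codable R"
    by (rule rel_codable_subset[OF codable_nums codable_X])
      (use avoid avoid_subset in \<open>auto simp: R_def\<close>)
  then have g: "mem p (rel_code mem R) \<longleftrightarrow> (\<exists>i\<le>l. p = kpair mem (num mem i) (f i))" for p
    unfolding rel_codable_def rel_code_def by (auto simp: R_def)
  have "internal_path mem nat_le nat_less nat_Suc (num mem 0) avoid_rel (E m) (num mem r) x y
      (num mem l) (rel_code mem R)"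
  proof (rule internal_pathI)
    fix p assume "mem p (rel_code mem R)"
    then show "\<exists>i y. p = kpair mem i y \<and> (i, num mem l) \<in> nat_le" unfolding g by force
  next
    fix i assume "(i, num mem l) \<in> nat_le"
    then obtain k where "i = num mem k" "k \<le> l" by (auto elim: nat_relE)
    then show "\<exists>y. mem (kpair mem i y) (rel_code mem R) \<and> (y, num mem r) \<in> avoid_rel \<and>
        (\<forall>z. mem (kpair mem i z) (rel_code mem R) \<longrightarrow> z = y)"
      using avoid by (simp add: g)
  next
    fix i j y z assume "(i, num mem l) \<in> nat_less" "(i, j) \<in> nat_Suc"
      "mem (kpair mem i y) (rel_code mem R)" "mem (kpair mem j z) (rel_code mem R)"
    moreover from this obtain k where "k < l" "i = num mem k" "j = num mem (Suc k)"
      by (auto elim!: nat_relE)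
    ultimately have "y = f k" "z = f (Suc k)" by (simp_all add: g)
    then show "(y, z) \<in> E m" using f(3) \<open>k < l\<close> by (simp add: step_def)
  qed (use f in \<open>auto simp: g\<close>)
  then show "\<exists>n\<in>range (num mem). \<exists>g.
     internal_path mem nat_le nat_less nat_Suc (num mem 0) avoid_rel (E m) (num mem r) x y n g"
    by blast
next
  assume "\<exists>n\<in>range (num mem). \<exists>g.
     internal_path mem nat_le nat_less nat_Suc (num mem 0) avoid_rel (E m) (num mem r) x y n g"
  then obtain l g where
    path: "internal_path mem nat_le nat_less nat_Suc (num mem 0) avoid_rel (E m) (num mem r) x y
      (num mem l) g" by blast
  define f where "f i = (THE z. mem (kpair mem (num mem i) z) g)" for i
  have f: "mem (kpair mem (num mem i) (f i)) g \<and> f i \<in> avoid r" if "i \<le> l" for i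
  proof -
    have il: "(num mem i, num mem l) \<in> nat_le" using that by simp
    obtain z where z: "mem (kpair mem (num mem i) z) g" "z \<in> avoid r"
      "\<And>z'. mem (kpair mem (num mem i) z') g \<Longrightarrow> z' = z"
      using internal_pathD(2)[OF path il] unfolding avoid_rel_iff by blast
    have "f i = z" unfolding f_def by (intro the_equality z(1,3))
    then show ?thesis using z(1,2) by simp
  qed
  have f_unique: "z = f i" if "i \<le> l" "mem (kpair mem (num mem i) z) g" for i z
  proof -
    have il: "(num mem i, num mem l) \<in> nat_le" using that by simp
    obtain w where "\<And>z'. mem (kpair mem (num mem i) z') g \<Longrightarrow> z' = w"
      using internal_pathD(2)[OF path il] by blast
    then show ?thesis using f[OF that(1)] that(2) by blast
  qed
  have f_step: "(f i, f (Suc i)) \<in> step m r" if "i < l" for i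
  proof -
    have "(num mem i, num mem l) \<in> nat_less" "(num mem i, num mem (Suc i)) \<in> nat_Suc"
      using that by simp_all
    then have "(f i, f (Suc i)) \<in> E m"
      by (rule internal_pathD(3)[OF path]) (use f[of i] f[of "Suc i"] that in simp_all)
    then show ?thesis using f[of i] f[of "Suc i"] that by (simp add: step_def)
  qed
  have ends: "x = f 0" "y = f l"
    by (rule f_unique[OF le0 internal_pathD(4)[OF path]])
      (rule f_unique[OF order_refl internal_pathD(5)[OF path]])
  show "(x, y) \<in> (step m r)\<^sup>+"
  \<comment> \<open>A coded path may have length 0; it then corresponds to one reflexive step inside
    \<open>avoid r\<close>.\<close>
  proof (cases "l = 0")
    case True
    then show ?thesis using ends f[of 0] step_refl by auto
  next
    case False
    have "(x, y) \<in> step m r ^^ l" unfolding relpow_fun_conv using ends f_step by blast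
    then show ?thesis using False unfolding trancl_power by blast
  qed
qed

text \<open>Transfer of the preceding equivalence with \<open>r\<close> quantified, hence available
  for infinite \<open>r\<close> too.\<close>

lemma star_conn_rel_iff:
  assumes "r \<in> hypernats"
  shows "(r, kpair nmem a b) \<in> star_rel (conn_rel m) \<longleftrightarrow> (\<exists>n\<in>hypernats. \<exists>g.
     internal_path nmem hyper_le hyper_less hyper_Suc (star (num mem 0)) (star_rel avoid_rel)
       (star_rel (E m)) r a b n g)"
proof -
  let ?ps = "[rel_code mem nat_le, rel_code mem nat_less, rel_code mem nat_Suc, num mem 0,
    rel_code mem avoid_rel, rel_code mem (E m), rel_code mem (conn_rel m),
    code mem (range (num mem))]"
  have std_Path: "sat mem Path (((!) ?ps)(10 := r, 11 := a, 12 := b, 13 := n, 14 := g)) \<longleftrightarrow>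
      internal_path mem nat_le nat_less nat_Suc (num mem 0) avoid_rel (E m) r a b n g" for r a b n g
    by (subst std.sat_Path[where le = nat_le and lt = nat_less and suc = nat_Suc
          and A = avoid_rel and S = "E m"]) simp_all
  have ns_Path: "sat nmem Path ((star \<circ> (!) ?ps)(10 := r, 11 := a, 12 := b, 13 := n, 14 := g)) \<longleftrightarrow>
      internal_path nmem hyper_le hyper_less hyper_Suc (star (num mem 0)) (star_rel avoid_rel)
       (star_rel (E m)) r a b n g" for r a b n g
    by (subst ns.sat_Path[where le = hyper_le and lt = hyper_less and suc = hyper_Suc
          and A = "star_rel avoid_rel" and S = "star_rel (E m)"])
      (simp_all add: hypernat_relations)
  have "sat nmem (All 10 (Imp (Mem 10 7) (All 11 (All 12 (Iff (Rel3 6 10 11 12)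
      (Exists 13 (Conj (Mem 13 7) (Exists 14 Path)))))))) (star \<circ> (!) ?ps)"
  proof (rule transferI)
    show "sat mem (All 10 (Imp (Mem 10 7) (All 11 (All 12 (Iff (Rel3 6 10 11 12)
      (Exists 13 (Conj (Mem 13 7) (Exists 14 Path)))))))) ((!) ?ps)"
      by (clarsimp simp: std_Path trancl_iff_internal_path)
  qed
  then show ?thesis using assms by (simp add: ns_Path hypernats_def) blast
qed

section \<open>Iota-equivalence in terms of standard step sizes and radii\<close>

text \<open>Each step of the given path lies in some standard \<open>E m\<close>, a priori depending
  on the step. Were no \<open>m\<close> good for all steps, saturation would give a single step
  outside every \<open>E m\<close>.\<close>

lemma iota_eq_imp_star_conn:
  assumes "(a, b) \<in> iota_eq X C \<xi>"
  shows "\<exists>m. \<forall>r. star_conn m r a b"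
proof -
  obtain n x where n: "n \<in> hypernats" and "internal_seq n x"
    and INF: "\<And>i. i \<in> hypernats \<Longrightarrow> (i, n) \<in> hyper_le \<Longrightarrow> x i \<in> INF_points X C \<xi>"
    and ends: "x (star (num mem 0)) = a" "x n = b"
    and close: "\<And>i j. (i, n) \<in> hyper_less \<Longrightarrow> (i, j) \<in> hyper_Suc \<Longrightarrow>
      finitely_close C (x i) (x j)"
    using assms unfolding iota_eq_def by blast
  then obtain g where "elts nmem g = (\<lambda>i. kpair nmem i (x i)) ` {i \<in> hypernats. (i, n) \<in> hyper_le}"
    unfolding internal_seq_def by blast
  then have g: "nmem p g \<longleftrightarrow> (\<exists>i\<in>hypernats. (i, n) \<in> hyper_le \<and> p = kpair nmem i (x i))" for p
    by (auto simp: elts_def set_eq_iff)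
  have "\<exists>m. \<forall>i j. (i, n) \<in> hyper_less \<longrightarrow> (i, j) \<in> hyper_Suc \<longrightarrow> (x i, x j) \<in> star_rel (E m)"
  proof (rule ccontr)
    assume contr: "\<nexists>m. \<forall>i j. (i, n) \<in> hyper_less \<longrightarrow> (i, j) \<in> hyper_Suc \<longrightarrow>
      (x i, x j) \<in> star_rel (E m)"
    define bad where "bad m i \<longleftrightarrow> (i, n) \<in> hyper_less \<and>
      (\<exists>j. (i, j) \<in> hyper_Suc \<and> (x i, x j) \<notin> star_rel (E m))" for m i
    have "\<exists>F. \<forall>i. nmem i F \<longleftrightarrow> bad m i" for m
    proof -
      let ?ps = "[code mem (range (num mem)), rel_code mem nat_less, rel_code mem nat_Suc,
        rel_code mem (E m)]"
      \<comment> \<open>Internality of the set of bad indices. In the standard universe it is a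
        subset of the natural numbers, hence an element; \<open>n\<close> and \<open>g\<close> are
        quantified because they are nonstandard.\<close>
      have "sat nmem (All 10 (All 11 (Exists 12 (All 13 (Iff (Mem 13 12) (Conj (Rel 1 13 10)
        (Exists 14 (Exists 15 (Exists 16 (Conj (Conj (Rel 2 13 14) (Conj (Rel 11 13 15) (Rel 11 14 16)))
          (Neg (Rel 3 15 16))))))))))))
        (star \<circ> (!) ?ps)"
      proof (rule transferI)
        have "\<exists>F. \<forall>i. mem i F \<longleftrightarrow> (i, n) \<in> nat_less \<and> P i" for n P
        proof -
          have "codable {i. (i, n) \<in> nat_less \<and> P i}"
            by (rule codable_subset[OF codable_nums]) (auto elim: nat_relE)
          then show ?thesis
            by (intro exI[of _ "code mem {i. (i, n) \<in> nat_less \<and> P i}"]) simp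
        qed
        then show "sat mem (All 10 (All 11 (Exists 12 (All 13 (Iff (Mem 13 12) (Conj (Rel 1 13 10)
        (Exists 14 (Exists 15 (Exists 16 (Conj (Conj (Rel 2 13 14) (Conj (Rel 11 13 15) (Rel 11 14 16)))
          (Neg (Rel 3 15 16)))))))))))) ((!) ?ps)"
          by simp
      qed
      then obtain F where F: "\<And>i. nmem i F \<longleftrightarrow> (i, n) \<in> hyper_less \<and>
        (\<exists>j y z. (i, j) \<in> hyper_Suc \<and> nmem (kpair nmem i y) g \<and> nmem (kpair nmem j z) g \<and>
          (y, z) \<notin> star_rel (E m))"
        by (simp add: hypernat_relations) blast
      have "nmem i F \<longleftrightarrow> bad m i" for i
      proof -
        have "nmem (kpair nmem i y) g \<longleftrightarrow> y = x i" "nmem (kpair nmem j z) g \<longleftrightarrow> z = x j"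
          if "(i, n) \<in> hyper_less" "(i, j) \<in> hyper_Suc" for j y z
          using hyper_step_le[OF that] hyper_le_hypernats unfolding g by auto
        then show ?thesis
          by (cases "(i, n) \<in> hyper_less") (simp_all add: F bad_def cong: conj_cong)
      qed
      then show ?thesis by blast
    qed
    then obtain F where F: "\<And>m i. nmem i (F m) \<longleftrightarrow> bad m i" by metis
    have "\<exists>i. \<forall>m. nmem i (F m)"
    proof (rule countable_saturation)
      show "\<exists>i. nmem i (F m)" for m using contr unfolding F bad_def by blast
      show "nmem i (F m)" if "m \<le> m'" "nmem i (F m')" for m m' i
        using that star_base_mono[OF that(1)] unfolding F bad_def by blast
    qed
    then obtain i where i: "\<And>m. bad m i" unfolding F by blast
    then obtain j where j: "(i, j) \<in> hyper_Suc" "(i, n) \<in> hyper_less" unfolding bad_def by blast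
    then obtain m where "(x i, x j) \<in> star_rel (E m)"
      using close unfolding finitely_close_iff by blast
    then show False using i[of m] j hyper_Suc_unique unfolding bad_def by blast
  qed
  then obtain m where m: "\<And>i j. (i, n) \<in> hyper_less \<Longrightarrow> (i, j) \<in> hyper_Suc \<Longrightarrow>
      (x i, x j) \<in> star_rel (E m)" by blast
  \<comment> \<open>The same path \<open>g\<close> serves every standard \<open>r\<close>, since all
    its points are at infinity.\<close>
  have "star_conn m r a b" for r
  proof -
    have "internal_path nmem hyper_le hyper_less hyper_Suc (star (num mem 0)) (star_rel avoid_rel)
       (star_rel (E m)) (star (num mem r)) a b n g"
    proof (rule internal_pathI)
      show "\<exists>i y. p = kpair nmem i y \<and> (i, n) \<in> hyper_le" if "nmem p g" for p
        using that unfolding g by blast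
      show "\<exists>y. nmem (kpair nmem i y) g \<and> (y, star (num mem r)) \<in> star_rel avoid_rel \<and>
          (\<forall>z. nmem (kpair nmem i z) g \<longrightarrow> z = y)" if i: "(i, n) \<in> hyper_le" for i
      proof -
        have "i \<in> hypernats" using hyper_le_hypernats[OF i] by simp
        moreover from this have "(x i, star (num mem r)) \<in> star_rel avoid_rel"
          using INF i INF_points_iff by blast
        ultimately show ?thesis using i by (auto simp: g)
      qed
      show "(y, z) \<in> star_rel (E m)" if "(i, n) \<in> hyper_less" "(i, j) \<in> hyper_Suc"
        "nmem (kpair nmem i y) g" "nmem (kpair nmem j z) g" for i j y z
        using that m by (auto simp: g)
      show "nmem (kpair nmem (star (num mem 0)) a) g" "nmem (kpair nmem n b) g"
        using ends zero_hyper_le[OF n] hyper_le_refl[OF n] n by (auto simp: g)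
    qed
    then show ?thesis
      unfolding star_conn_def star_conn_rel_iff[OF num_mem_hypernats] using n by blast
  qed
  then show ?thesis by blast
qed

text \<open>The internal sets of radii at least \<open>k\<close> at which \<open>a\<close> and
  \<open>b\<close> are connected decrease with \<open>k\<close>, and each contains the standard
  radius \<open>k\<close>; saturation gives a common, hence infinite, radius.\<close>

lemma star_conn_overspill:
  assumes "\<And>r. star_conn m r a b"
  shows "\<exists>r\<in>hypernats. (\<forall>k. (star (num mem k), r) \<in> hyper_le) \<and>
    (r, kpair nmem a b) \<in> star_rel (conn_rel m)"
proof -
  have "\<exists>F. \<forall>r. nmem r F \<longleftrightarrow> (star (num mem k), r) \<in> hyper_le \<and>
    (r, kpair nmem a b) \<in> star_rel (conn_rel m)" for k
  proof -
    let ?ps = "[rel_code mem nat_le, rel_code mem (conn_rel m), num mem k]"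
    have "sat nmem (All 10 (Exists 11 (All 12 (Iff (Mem 12 11) (Conj (Rel 0 2 12) (Rel 1 12 10))))))
      (star \<circ> (!) ?ps)"
    proof (rule transferI)
      have "\<exists>F. \<forall>r. mem r F \<longleftrightarrow> (num mem k, r) \<in> nat_le \<and> P r" for P
      proof -
        have "codable {r. (num mem k, r) \<in> nat_le \<and> P r}"
          by (rule codable_subset[OF codable_nums]) (auto elim: nat_relE)
        then show ?thesis
          by (intro exI[of _ "code mem {r. (num mem k, r) \<in> nat_le \<and> P r}"]) simp
      qed
      then show "sat mem (All 10 (Exists 11 (All 12 (Iff (Mem 12 11) (Conj (Rel 0 2 12)
        (Rel 1 12 10)))))) ((!) ?ps)"
        by simp
    qed
    then show ?thesis by (simp add: hypernat_relations)
  qed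
  then obtain F where F: "\<And>k r. nmem r (F k) \<longleftrightarrow> (star (num mem k), r) \<in> hyper_le \<and>
    (r, kpair nmem a b) \<in> star_rel (conn_rel m)" by metis
  have "\<exists>r. \<forall>k. nmem r (F k)"
  proof (rule countable_saturation)
    fix k
    have "nmem (star (num mem k)) (F k)"
      using assms[of k] hyper_le_refl[OF num_mem_hypernats] unfolding F star_conn_def by blast
    then show "\<exists>r. nmem r (F k)" by blast
  next
    fix k l r assume "k \<le> l" "nmem r (F l)"
    moreover from this have "(star (num mem k), star (num mem l)) \<in> hyper_le"
      by (simp add: hypernat_relations)
    ultimately show "nmem r (F k)" using hyper_le_trans unfolding F by blast
  qed
  then obtain r where "\<And>k. (star (num mem k), r) \<in> hyper_le"
    "(r, kpair nmem a b) \<in> star_rel (conn_rel m)" unfolding F by blast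
  then show ?thesis using hyper_le_hypernats by blast
qed

lemma star_avoid_antimono:
  assumes "(star (num mem k), r) \<in> hyper_le" "(x, r) \<in> star_rel avoid_rel"
  shows "(x, star (num mem k)) \<in> star_rel avoid_rel"
proof -
  have "sat nmem (All 10 (All 11 (Imp (Rel 0 2 10) (Imp (Rel 1 11 10) (Rel 1 11 2)))))
    (star \<circ> (!) [rel_code mem nat_le, rel_code mem avoid_rel, num mem k])"
    by (rule transferI) (auto elim!: nat_relE simp: avoid_def)
  then show ?thesis using assms by (simp add: hypernat_relations)
qed

text \<open>A path avoiding balls up to an infinite radius avoids those of every standard index, so
  it runs through points at infinity, with steps in one standard \<open>E m\<close>.\<close>

lemma star_conn_imp_iota_eq:
  assumes a: "a \<in> INF_points X C \<xi>" and b: "b \<in> INF_points X C \<xi>"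
    and conn: "\<And>r. star_conn m r a b"
  shows "(a, b) \<in> iota_eq X C \<xi>"
proof -
  obtain r where r: "r \<in> hypernats" "\<And>k. (star (num mem k), r) \<in> hyper_le"
    "(r, kpair nmem a b) \<in> star_rel (conn_rel m)"
    using star_conn_overspill[OF conn] by blast
  then obtain n g where n: "n \<in> hypernats" and
    path: "internal_path nmem hyper_le hyper_less hyper_Suc (star (num mem 0))
      (star_rel avoid_rel) (star_rel (E m)) r a b n g"
    unfolding star_conn_rel_iff[OF r(1)] by blast
  \<comment> \<open>Reads the coded graph as a function; its values are determined only for
    \<open>i\<close> up to \<open>n\<close>.\<close>
  define x where "x i = (THE y. nmem (kpair nmem i y) g)" for i
  have x: "nmem (kpair nmem i y) g \<longleftrightarrow> y = x i" "(x i, r) \<in> star_rel avoid_rel"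
    if "(i, n) \<in> hyper_le" for i y
  proof -
    obtain z where z: "nmem (kpair nmem i z) g" "(z, r) \<in> star_rel avoid_rel"
      "\<And>y. nmem (kpair nmem i y) g \<Longrightarrow> y = z"
      using internal_pathD(2)[OF path \<open>(i, n) \<in> hyper_le\<close>] by blast
    have "x i = z" unfolding x_def by (intro the_equality z(1,3))
    then show "nmem (kpair nmem i y) g \<longleftrightarrow> y = x i" "(x i, r) \<in> star_rel avoid_rel"
      using z by blast+
  qed
  have "nmem p g \<longleftrightarrow> (\<exists>i\<in>hypernats. (i, n) \<in> hyper_le \<and> p = kpair nmem i (x i))" for p
  proof
    assume p: "nmem p g"
    then obtain i y where iy: "p = kpair nmem i y" "(i, n) \<in> hyper_le"
      using internal_pathD(1)[OF path] by blast
    then have "y = x i" using p x(1) by simp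
    then show "\<exists>i\<in>hypernats. (i, n) \<in> hyper_le \<and> p = kpair nmem i (x i)"
      using iy hyper_le_hypernats[OF iy(2)] by blast
  qed (use x(1) in auto)
  then have "internal_seq n x"
    unfolding internal_seq_def by (intro exI[of _ g]) (auto simp: elts_def)
  moreover have "x i \<in> INF_points X C \<xi>" if "(i, n) \<in> hyper_le" for i
    unfolding INF_points_iff using star_avoid_antimono[OF r(2) x(2)[OF that]] by blast
  moreover have "x (star (num mem 0)) = a" "x n = b"
    using x(1)[OF zero_hyper_le[OF n], THEN iffD1, OF internal_pathD(4)[OF path]]
      x(1)[OF hyper_le_refl[OF n], THEN iffD1, OF internal_pathD(5)[OF path]] by simp_all
  moreover have "finitely_close C (x i) (x j)"
    if "(i, n) \<in> hyper_less" "(i, j) \<in> hyper_Suc" for i j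
  proof -
    have "nmem (kpair nmem i (x i)) g" "nmem (kpair nmem j (x j)) g"
      using hyper_step_le[OF that] x(1) by blast+
    then show ?thesis
      using internal_pathD(3)[OF path that] unfolding finitely_close_iff by blast
  qed
  ultimately show ?thesis
    unfolding iota_eq_def using a b n by blast
qed

lemma iota_eq_iff:
  "(a, b) \<in> iota_eq X C \<xi> \<longleftrightarrow> a \<in> INF_points X C \<xi> \<and> b \<in> INF_points X C \<xi> \<and>
     (\<exists>m. \<forall>r. star_conn m r a b)"
proof
  assume ab: "(a, b) \<in> iota_eq X C \<xi>"
  then have "a \<in> INF_points X C \<xi> \<and> b \<in> INF_points X C \<xi>" by (simp add: iota_eq_def)
  then show "a \<in> INF_points X C \<xi> \<and> b \<in> INF_points X C \<xi> \<and> (\<exists>m. \<forall>r. star_conn m r a b)"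
    using iota_eq_imp_star_conn[OF ab] by simp
qed (use star_conn_imp_iota_eq in blast)

lemma iota_eq_sym: "(a, b) \<in> iota_eq X C \<xi> \<Longrightarrow> (b, a) \<in> iota_eq X C \<xi>"
  unfolding iota_eq_iff using star_conn_sym by blast

text \<open>Joining hyperfinite paths is left to transitivity of \<open>star_conn\<close>, after
  both step sizes are raised to their maximum.\<close>

lemma iota_eq_trans:
  assumes "(a, b) \<in> iota_eq X C \<xi>" "(b, c) \<in> iota_eq X C \<xi>"
  shows "(a, c) \<in> iota_eq X C \<xi>"
proof -
  obtain m m' where m: "\<And>r. star_conn m r a b" and m': "\<And>r. star_conn m' r b c"
    using assms unfolding iota_eq_iff by blast
  have "star_conn (max m m') r a c" for r
    by (rule star_conn_trans[of _ _ _ b]; rule star_conn_mono[rotated], rule m m') simp_all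
  then show ?thesis using assms unfolding iota_eq_iff by blast
qed

lemma iota_eq_class:
  assumes "(a, b) \<in> iota_eq X C \<xi>"
  shows "iota_eq X C \<xi> `` {a} = iota_eq X C \<xi> `` {b}"
  using iota_eq_trans[OF assms] iota_eq_trans[OF iota_eq_sym[OF assms]] by blast

section \<open>Comparison of the two equivalences and injectivity\<close>

text \<open>Both sides are compared with \<open>ends_connected\<close>. From right to left this
  gives well-definedness of the map on classes, from left to right its injectivity.\<close>

lemma star_seq_iota_eq_iff:
  assumes s: "s \<in> coarse_seqs X C \<xi>" and t: "t \<in> coarse_seqs X C \<xi>"
    and i: "i \<in> infinite_hypernats" and j: "j \<in> infinite_hypernats"
  shows "(star_seq s i, star_seq t j) \<in> iota_eq X C \<xi> \<longleftrightarrow> (s, t) \<in> sigma_eq X C \<xi>"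
proof
  assume "(star_seq s i, star_seq t j) \<in> iota_eq X C \<xi>"
  then obtain m where "\<And>r. star_conn m r (star_seq s i) (star_seq t j)"
    unfolding iota_eq_iff by blast
  then have "\<exists>i\<ge>K. \<exists>j\<ge>K. (s i, t j) \<in> (step m r)\<^sup>+" for r K
    by (rule star_conn_seqD[OF coarse_seq_range[OF s] coarse_seq_range[OF t] i j])
  then have "ends_connected s t" by (rule ends_connectedI[OF s t])
  then show "(s, t) \<in> sigma_eq X C \<xi>" by (rule ends_connected_imp_sigma_eq[OF s t])
next
  assume "(s, t) \<in> sigma_eq X C \<xi>"
  then have "ends_connected s t" by (rule sigma_eq_imp_ends_connected)
  then obtain m where m: "\<And>r. \<exists>K. \<forall>i\<ge>K. \<forall>j\<ge>K. (s i, t j) \<in> (step m r)\<^sup>+"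
    unfolding ends_connected_def by blast
  have "star_conn m r (star_seq s i) (star_seq t j)" for r
    using m[of r] star_conn_seqI[OF coarse_seq_range[OF s] coarse_seq_range[OF t] _ i j] by blast
  then show "(star_seq s i, star_seq t j) \<in> iota_eq X C \<xi>"
    unfolding iota_eq_iff using star_seq_INF[OF s i] star_seq_INF[OF t j] by blast
qed

text \<open>Evaluates the definite description in \<open>omega\<close>: all representatives and
  infinite indices give the same class, and the pair \<open>s\<close>, \<open>i\<close> already
  determines it.\<close>

lemma omega_sigma_class:
  assumes s: "s \<in> coarse_seqs X C \<xi>" and i: "i \<in> infinite_hypernats"
  shows "omega X C \<xi> (sigma_eq X C \<xi> `` {s}) = iota_eq X C \<xi> `` {star_seq s i}"
  unfolding omega_def
proof (rule the_equality)
  have "iota_eq X C \<xi> `` {star_seq s i} = iota_eq X C \<xi> `` {star_seq t j}"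
    if "(s, t) \<in> sigma_eq X C \<xi>" "j \<in> infinite_hypernats" for t j
  proof -
    have "t \<in> coarse_seqs X C \<xi>"
      using sigma_eq_sym[OF that(1)] by (simp add: sigma_eq_iff)
    then have "(star_seq s i, star_seq t j) \<in> iota_eq X C \<xi>"
      using star_seq_iota_eq_iff[OF s _ i that(2)] that(1) by blast
    then show ?thesis by (rule iota_eq_class)
  qed
  moreover have "iota_eq X C \<xi> `` {star_seq s i} \<in> iota X C \<xi>"
    unfolding iota_def by (rule quotientI[OF star_seq_INF[OF s i]])
  ultimately show "iota_eq X C \<xi> `` {star_seq s i} \<in> iota X C \<xi> \<and>
    (\<forall>t\<in>sigma_eq X C \<xi> `` {s}. \<forall>j\<in>infinite_hypernats.
      iota_eq X C \<xi> `` {star_seq s i} = iota_eq X C \<xi> `` {star_seq t j})"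
    by blast
next
  fix k assume k: "k \<in> iota X C \<xi> \<and> (\<forall>t\<in>sigma_eq X C \<xi> `` {s}. \<forall>j\<in>infinite_hypernats.
    k = iota_eq X C \<xi> `` {star_seq t j})"
  have "s \<in> sigma_eq X C \<xi> `` {s}" using s by (simp add: sigma_eq_iff)
  then show "k = iota_eq X C \<xi> `` {star_seq s i}" using k i by blast
qed

lemma inj_on_omega: "inj_on (omega X C \<xi>) (sigma X C \<xi>)"
proof (rule inj_onI)
  fix c c' assume "c \<in> sigma X C \<xi>" "c' \<in> sigma X C \<xi>" and eq: "omega X C \<xi> c = omega X C \<xi> c'"
  then obtain s t where s: "s \<in> coarse_seqs X C \<xi>" "c = sigma_eq X C \<xi> `` {s}"
    and t: "t \<in> coarse_seqs X C \<xi>" "c' = sigma_eq X C \<xi> `` {t}"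
    unfolding sigma_def quotient_def by blast
  obtain i where i: "i \<in> infinite_hypernats" using infinite_hypernats_nonempty by blast
  have "(t, t) \<in> sigma_eq X C \<xi>" using t by (simp add: sigma_eq_iff)
  then have "star_seq t i \<in> iota_eq X C \<xi> `` {star_seq t i}"
    using star_seq_iota_eq_iff[OF t(1) t(1) i i] by blast
  moreover have "iota_eq X C \<xi> `` {star_seq s i} = iota_eq X C \<xi> `` {star_seq t i}"
    using eq unfolding s(2) t(2) omega_sigma_class[OF s(1) i] omega_sigma_class[OF t(1) i] .
  ultimately have "(star_seq s i, star_seq t i) \<in> iota_eq X C \<xi>" by blast
  then have st: "(s, t) \<in> sigma_eq X C \<xi>" using star_seq_iota_eq_iff[OF s(1) t(1) i i] by blast
  then show "c = c'"
    unfolding s(2) t(2) using sigma_eq_trans[OF st] sigma_eq_trans[OF sigma_eq_sym[OF st]] by blast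
qed

end

theorem theorem2p6:
  fixes mem :: "'u \<Rightarrow> 'u \<Rightarrow> bool"
    and nmem :: "'v \<Rightarrow> 'v \<Rightarrow> bool"
    and star :: "'u \<Rightarrow> 'v"
    and Cat :: "('u set \<times> ('u \<times> 'u) set set \<times> 'u) set"
    and X :: "'u set" and C :: "('u \<times> 'u) set set" and \<xi> :: 'u
  assumes "nonstandard_setting mem nmem star Cat"
    and "(X, C, \<xi>) \<in> Cat"
    and "metrisable X C"
  shows "inj_on (nonstandard_setting.omega mem nmem star X C \<xi>) (sigma X C \<xi>)"
proof -
  have "pointed_coarse_space X C \<xi>"
    by (rule nonstandard_setting.Cat_spaces[OF assms(1,2)])
  then have "coarse_structure X C" "\<xi> \<in> X"
    by (simp_all add: pointed_coarse_space_def)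
  then obtain E where E: "coarse_base X C \<xi> E"
    using metrisable_imp_coarse_base[OF _ _ assms(3)] by blast
  have "nonstandard_base mem nmem star Cat X C \<xi> E"
    by (rule nonstandard_base.intro[OF assms(1) E nonstandard_base_axioms.intro[OF assms(2)]])
  then show ?thesis by (rule nonstandard_base.inj_on_omega)
qed

end
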